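(* Let $r=\frac mn$ be a nonzero rational number written in lowest terms, with $r\neq\pm1$. Let $G$ be a non-elementary GBS group. Then $r$ belongs to the image of the modular homomorphism $\Delta_G$ if and only if $G$ contains a subgroup isomorphic to $BS(m,n)$.
   Context: For nonzero integers $m,n$, $BS(m,n)=\langle a,t\mid ta^mt^{-1}=a^n\rangle$. A generalized Baumslag-Solitar (GBS) group is a finitely generated group acting on a tree (without inversions) with all vertex and edge stabilizers infinite cyclic. A GBS group is elementary if it is isomorphic to $\mathbb{Z}$, $\mathbb{Z}^2$, or the Klein bottle group $BS(1,-1)$. Let $G$ be a non-elementary GBS group. An element is elliptic if it fixes a point in a tree on which $G$ acts with infinite cyclic vertex and edge stabilizers (this does not depend on the tree). The modular homomorphism $\Delta_G:G\to\mathbb{Q}^*$ is defined as follows: given $g\in G$ and any non-trivial elliptic element $a$, there is a relation $ga^mg^{-1}=a^n$ with $m,n\ne0$, and $\Delta_G(g)=\frac mn$ (this does not depend on the choice of $a$ or of the relation). *)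

theory Defs
  imports
    "Graph_Theory.Graph_Theory"
    "HOL-Algebra.Elementary_Groups"
    "HOL-Algebra.Group_Action"
    "HOL-Algebra.Generated_Groups"
begin

section \<open>Groups given by generators and relations\<close>

text \<open>
  A letter \<open>(x, True)\<close> stands for the generator \<open>x\<close>, and \<open>(x, False)\<close> for its inverse.
  The generators are all elements of the type \<open>'x\<close>. A pair \<open>(l, r)\<close> of words in the set of
  relations stands for the relation \<open>l = r\<close>.
\<close>

type_synonym 'x word = "('x \<times> bool) list"

inductive pres_eq :: "('x word \<times> 'x word) set \<Rightarrow> 'x word \<Rightarrow> 'x word \<Rightarrow> bool"
  for R :: "('x word \<times> 'x word) set" where
  pres_refl: "pres_eq R u u"
| pres_sym: "pres_eq R u v \<Longrightarrow> pres_eq R v u"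
| pres_trans: "pres_eq R u v \<Longrightarrow> pres_eq R v w \<Longrightarrow> pres_eq R u w"
| pres_cancel: "pres_eq R (u @ [(x, b), (x, \<not> b)] @ v) (u @ v)"
| pres_rel: "(l, r) \<in> R \<Longrightarrow> pres_eq R (u @ l @ v) (u @ r @ v)"

definition pres_class :: "('x word \<times> 'x word) set \<Rightarrow> 'x word \<Rightarrow> 'x word set" where
  "pres_class R u = {v. pres_eq R u v}"

definition presented_group :: "('x word \<times> 'x word) set \<Rightarrow> 'x word set monoid" where
  "presented_group R =
     \<lparr>carrier = range (pres_class R),
      monoid.mult = (\<lambda>X Y. \<Union>u\<in>X. \<Union>v\<in>Y. pres_class R (u @ v)),
      one = pres_class R []\<rparr>"

lemma pres_class_eq_iff: "pres_class R u = pres_class R v \<longleftrightarrow> pres_eq R u v"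
proof
  assume "pres_class R u = pres_class R v"
  then have "v \<in> pres_class R u"
    by (simp add: pres_class_def pres_refl)
  then show "pres_eq R u v"
    by (simp add: pres_class_def)
next
  assume "pres_eq R u v"
  then have "pres_eq R u w \<longleftrightarrow> pres_eq R v w" for w
    by (metis pres_trans pres_sym)
  then show "pres_class R u = pres_class R v"
    by (simp add: pres_class_def)
qed

lemma pres_eq_context: "pres_eq R u v \<Longrightarrow> pres_eq R (p @ u @ q) (p @ v @ q)"
proof (induction rule: pres_eq.induct)
  case (pres_refl u)
  show ?case by (rule pres_eq.pres_refl)
next
  case (pres_sym u v)
  show ?case by (rule pres_eq.pres_sym[OF pres_sym.IH])
next
  case (pres_trans u v w)
  show ?case by (rule pres_eq.pres_trans[OF pres_trans.IH])
next
  case (pres_cancel u x b v)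
  show ?case using pres_eq.pres_cancel[of R "p @ u" x b "v @ q"] by simp
next
  case (pres_rel l r u v)
  then show ?case using pres_eq.pres_rel[of l r R "p @ u" "v @ q"] by simp
qed

lemma pres_eq_append:
  assumes "pres_eq R u u'" "pres_eq R v v'"
  shows "pres_eq R (u @ v) (u' @ v')"
proof (rule pres_trans)
  show "pres_eq R (u @ v) (u' @ v)"
    using pres_eq_context[OF assms(1), of "[]" v] by simp
  show "pres_eq R (u' @ v) (u' @ v')"
    using pres_eq_context[OF assms(2), of u' "[]"] by simp
qed

lemma presented_group_mult:
  "pres_class R u \<otimes>\<^bsub>presented_group R\<^esub> pres_class R v = pres_class R (u @ v)"
proof -
  have "pres_class R (u' @ v') = pres_class R (u @ v)"
    if "u' \<in> pres_class R u" "v' \<in> pres_class R v" for u' v'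
  proof -
    have "pres_eq R u u'" "pres_eq R v v'"
      using that by (simp_all add: pres_class_def)
    then have "pres_eq R (u @ v) (u' @ v')"
      by (rule pres_eq_append)
    then show ?thesis
      by (simp only: pres_class_eq_iff[symmetric])
  qed
  then have "(\<Union>u'\<in>pres_class R u. \<Union>v'\<in>pres_class R v. pres_class R (u' @ v')) =
      (\<Union>u'\<in>pres_class R u. \<Union>v'\<in>pres_class R v. pres_class R (u @ v))"
    by simp
  moreover have "u \<in> pres_class R u" "v \<in> pres_class R v"
    by (simp_all add: pres_class_def pres_refl)
  then have "pres_class R u \<noteq> {}" "pres_class R v \<noteq> {}"
    by blast+
  ultimately show ?thesis
    by (simp add: presented_group_def)
qed

definition word_inv :: "'x word \<Rightarrow> 'x word" where
  "word_inv u = rev (map (\<lambda>(x, b). (x, \<not> b)) u)"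

lemma word_inv_left: "pres_eq R (word_inv u @ u) []"
proof (induction u)
  case (Cons y u)
  obtain x b where y: "y = (x, b)" by fastforce
  have "pres_eq R (word_inv u @ [(x, \<not> b), (x, \<not> \<not> b)] @ u) (word_inv u @ u)"
    by (rule pres_cancel)
  then have "pres_eq R (word_inv u @ [(x, \<not> b), (x, \<not> \<not> b)] @ u) []"
    by (rule pres_trans[OF _ Cons])
  then show ?case by (simp add: y word_inv_def)
qed (simp add: word_inv_def pres_refl)

lemma group_presented_group: "group (presented_group R)"
proof (rule groupI)
  fix X assume "X \<in> carrier (presented_group R)"
  then obtain u where u: "X = pres_class R u" by (auto simp: presented_group_def)
  have "pres_class R (word_inv u) \<otimes>\<^bsub>presented_group R\<^esub> X = pres_class R []"
    unfolding u presented_group_mult pres_class_eq_iff by (rule word_inv_left)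
  moreover have "\<one>\<^bsub>presented_group R\<^esub> = pres_class R []"
    "pres_class R (word_inv u) \<in> carrier (presented_group R)"
    by (simp_all add: presented_group_def)
  ultimately show "\<exists>Y\<in>carrier (presented_group R).
      Y \<otimes>\<^bsub>presented_group R\<^esub> X = \<one>\<^bsub>presented_group R\<^esub>"
    by metis
next
  have car: "carrier (presented_group R) = range (pres_class R)"
    and one: "\<one>\<^bsub>presented_group R\<^esub> = pres_class R []"
    by (simp_all add: presented_group_def)
  fix X Y Z
  show "\<one>\<^bsub>presented_group R\<^esub> \<in> carrier (presented_group R)"
    by (simp add: car one)
  show "X \<otimes>\<^bsub>presented_group R\<^esub> Y \<in> carrier (presented_group R)"
    if "X \<in> carrier (presented_group R)" "Y \<in> carrier (presented_group R)"
    using that by (auto simp: car presented_group_mult)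
  show "X \<otimes>\<^bsub>presented_group R\<^esub> Y \<otimes>\<^bsub>presented_group R\<^esub> Z =
      X \<otimes>\<^bsub>presented_group R\<^esub> (Y \<otimes>\<^bsub>presented_group R\<^esub> Z)"
    if "X \<in> carrier (presented_group R)" "Y \<in> carrier (presented_group R)"
      "Z \<in> carrier (presented_group R)"
    using that by (auto simp: car presented_group_mult)
  show "\<one>\<^bsub>presented_group R\<^esub> \<otimes>\<^bsub>presented_group R\<^esub> X = X"
    if "X \<in> carrier (presented_group R)"
    using that by (auto simp: car one presented_group_mult)
qed

section \<open>Baumslag--Solitar groups\<close>

datatype bs_gen = Gen_a | Gen_t

definition gen_pow :: "'x \<Rightarrow> int \<Rightarrow> 'x word" where
  "gen_pow x k = replicate (nat \<bar>k\<bar>) (x, 0 \<le> k)"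

definition BS :: "int \<Rightarrow> int \<Rightarrow> bs_gen word set monoid" where
  "BS m n = presented_group
     {(gen_pow Gen_t 1 @ gen_pow Gen_a m @ gen_pow Gen_t (-1), gen_pow Gen_a n)}"

section \<open>Generalized Baumslag--Solitar groups\<close>

definition finitely_generated_group :: "('g, 's) monoid_scheme \<Rightarrow> bool" where
  "finitely_generated_group G \<longleftrightarrow>
     group G \<and> (\<exists>S. finite S \<and> S \<subseteq> carrier G \<and> generate G S = carrier G)"

definition infinite_cyclic_subgroup :: "'g set \<Rightarrow> ('g, 's) monoid_scheme \<Rightarrow> bool" where
  "infinite_cyclic_subgroup H G \<longleftrightarrow> subgroup H G \<and> G\<lparr>carrier := H\<rparr> \<cong> integer_group"

text \<open>
  Graphs are simple and undirected: an edge between \<open>x\<close> and \<open>y\<close> is represented by the two arcs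
  \<open>(x, y)\<close> and \<open>(y, x)\<close>, and there are no loops. The constant \<^const>\<open>tree\<close> of the
  digraph library is not usable here, because it counts the closed walk \<open>x, y, x\<close> as a cycle.
  The vertex set may be infinite; connectedness includes that it is nonempty.
\<close>

definition undirected_tree :: "'v pair_pre_digraph \<Rightarrow> bool" where
  "undirected_tree T \<longleftrightarrow>
     pair_bidirected_digraph T \<and> connected (with_proj T) \<and>
     (\<forall>p. pre_digraph.cycle (with_proj T) p \<longrightarrow> length p < 3)"

text \<open>
  In the absence of inversions, the stabilizer of an edge fixes both of its endpoints.
\<close>

locale GBS_action = group_action G "pverts T" \<phi>
  for G :: "('g, 's) monoid_scheme" (structure)
    and T :: "'v pair_pre_digraph"
    and \<phi> :: "'g \<Rightarrow> 'v \<Rightarrow> 'v" +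
  assumes finitely_generated: "finitely_generated_group G"
    and tree: "undirected_tree T"
    and preserves_edges:
      "\<lbrakk>g \<in> carrier G; (x, y) \<in> parcs T\<rbrakk> \<Longrightarrow> (\<phi> g x, \<phi> g y) \<in> parcs T"
    and no_inversions:
      "\<lbrakk>g \<in> carrier G; (x, y) \<in> parcs T\<rbrakk> \<Longrightarrow> \<not> (\<phi> g x = y \<and> \<phi> g y = x)"
    and vertex_stabilizers:
      "x \<in> pverts T \<Longrightarrow> infinite_cyclic_subgroup (stabilizer G \<phi> x) G"
    and edge_stabilizers:
      "(x, y) \<in> parcs T \<Longrightarrow>
         infinite_cyclic_subgroup (stabilizer G \<phi> x \<inter> stabilizer G \<phi> y) G"

definition elementary_GBS :: "('g, 's) monoid_scheme \<Rightarrow> bool" where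
  "elementary_GBS G \<longleftrightarrow>
     G \<cong> integer_group \<or> G \<cong> integer_group \<times>\<times> integer_group \<or> G \<cong> BS 1 (-1)"

text \<open>
  Since the action has no inversions, an element fixing a point in the interior of an edge fixes
  its endpoints as well; so it suffices to consider fixed vertices.
\<close>

definition elliptic ::
  "('g, 's) monoid_scheme \<Rightarrow> 'v pair_pre_digraph \<Rightarrow> ('g \<Rightarrow> 'v \<Rightarrow> 'v) \<Rightarrow> 'g \<Rightarrow> bool" where
  "elliptic G T \<phi> g \<longleftrightarrow> g \<in> carrier G \<and> (\<exists>x\<in>pverts T. \<phi> g x = x)"

text \<open>
  The value is meaningful if \<open>G\<close> is not elementary: then it depends neither on \<open>a\<close>,
  nor on \<open>m\<close> and \<open>n\<close>, nor on the tree.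
\<close>

definition modular_hom ::
  "('g, 's) monoid_scheme \<Rightarrow> 'v pair_pre_digraph \<Rightarrow> ('g \<Rightarrow> 'v \<Rightarrow> 'v) \<Rightarrow> 'g \<Rightarrow> rat" where
  "modular_hom G T \<phi> g =
     (THE q. \<exists>a (m::int) (n::int).
        elliptic G T \<phi> a \<and> a \<noteq> \<one>\<^bsub>G\<^esub> \<and> m \<noteq> 0 \<and> n \<noteq> 0 \<and>
        g \<otimes>\<^bsub>G\<^esub> (a [^]\<^bsub>G\<^esub> m) \<otimes>\<^bsub>G\<^esub> inv\<^bsub>G\<^esub> g = a [^]\<^bsub>G\<^esub> n \<and>
        q = of_int m / of_int n)"

end

theory Submission
  imports Defs
begin

text \<open>
  Write \<open>\<Delta>\<close> for the modular homomorphism. The vertex stabilizers are pairwise commensurable, so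
  \<open>\<Delta>\<close> is well defined with respect to the given tree; it is multiplicative and trivial on elliptic
  elements.

  If \<open>G\<close> contains \<open>BS m n\<close>, let \<open>a\<close> and \<open>t\<close> be the images of its generators, so that
  \<open>t a\<^sup>m t\<^sup>-\<^sup>1 = a\<^sup>n\<close>. If \<open>a\<close> were hyperbolic, comparing translation lengths would give \<open>\<bar>m\<bar> = \<bar>n\<bar>\<close>
  (\<open>hyperbolic_conj_powers\<close>), that is \<open>r = \<plusminus>1\<close>. Hence \<open>a\<close> is elliptic. It is nontrivial, as the
  affine action of \<open>BS m n\<close> on the rationals shows, and so \<open>\<Delta> t = m / n\<close>.

  Conversely let \<open>\<Delta> t = m / n\<close>. There is an elliptic \<open>c \<noteq> 1\<close> with \<open>t c\<^sup>m t\<^sup>-\<^sup>1 = c\<^sup>n\<close>, and the problem is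
  to make the resulting homomorphism from \<open>BS m n\<close> injective. If \<open>m\<close> or \<open>n\<close> is \<open>\<plusminus>1\<close>, then, up to
  exchanging \<open>t\<close> and \<open>t\<^sup>-\<^sup>1\<close>, every element of \<open>BS m n\<close> has the form \<open>t\<^sup>i a\<^sup>k t\<^sup>-\<^sup>j\<close>, and \<open>\<Delta>\<close> detects \<open>i - j\<close>,
  so any \<open>c\<close> will do.

  If \<open>\<bar>m\<bar>\<close> and \<open>\<bar>n\<bar>\<close> are at least two, then \<open>t\<close> has an axis, since elliptic elements have modulus one.
  Along the axis the stabilizers cannot grow forever, so there is a vertex \<open>v\<close> on it with maximal
  stabilizer (\<open>axis_maximal_stab\<close>). Let \<open>b\<close> generate this stabilizer. As \<open>m\<close> and \<open>n\<close> are coprime, \<open>b\<close> has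
  a power \<open>c\<close> such that \<open>t c\<^sup>m t\<^sup>-\<^sup>1 = c\<^sup>n\<close>, that \<open>c\<^sup>n\<close> generates the stabilizer of \<open>t v\<close> in \<open>stab v\<close>, and that
  \<open>c\<^sup>m\<close> generates the stabilizer of \<open>t\<^sup>-\<^sup>1 v\<close> in \<open>stab v\<close>. The homomorphism sending the generators to \<open>c\<close> and
  \<open>t\<close> need not be injective, but the one sending them to \<open>c\<close> and \<open>h = t b t\<^sup>-\<^sup>1 b t\<close> is: the path from \<open>v\<close> to
  \<open>h v\<close> is so long compared with the parts of it that powers of \<open>c\<close> can fix that a product in \<open>c\<close>
  and \<open>h\<close> which is reduced in the sense of Britton's lemma moves \<open>v\<close> (\<open>ping_pong_pair_exists\<close>,
  \<open>ping_pong_invariant\<close>). Since every element of \<open>BS m n\<close> is a power of \<open>a\<close> or such a product times a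
  power of \<open>a\<close>, the kernel is trivial. The path is controlled by Gromov products, which in a tree measure
  common parts of geodesics.
\<close>

section \<open>Metric geometry of trees\<close>

fun common_prefix_length :: "'a list \<Rightarrow> 'a list \<Rightarrow> nat" where
  "common_prefix_length (x # xs) (y # ys) = (if x = y then Suc (common_prefix_length xs ys) else 0)"
| "common_prefix_length _ _ = 0"

lemma common_prefix_length_ultrametric:
  "min (common_prefix_length xs ys) (common_prefix_length ys zs) \<le> common_prefix_length xs zs"
proof (induction xs ys arbitrary: zs rule: common_prefix_length.induct)
  case (1 x xs y ys)
  then show ?case by (cases zs) auto
qed auto

locale tree_graph =
  fixes T :: "'v pair_pre_digraph"
  assumes is_tree: "undirected_tree T"
begin

lemma arcs_in_verts: "(x, y) \<in> parcs T \<Longrightarrow> x \<in> pverts T \<and> y \<in> pverts T"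
  using is_tree pair_wf_digraph.in_arcsD1 pair_wf_digraph.in_arcsD2
  unfolding undirected_tree_def pair_bidirected_digraph_def pair_sym_digraph_def by metis

lemma arcs_sym: "(x, y) \<in> parcs T \<Longrightarrow> (y, x) \<in> parcs T"
  using is_tree unfolding undirected_tree_def pair_bidirected_digraph_def pair_sym_digraph_def
    pair_sym_digraph_axioms_def symmetric_def by (auto dest: symD)

lemma no_loop: "(x, x) \<notin> parcs T"
  using is_tree unfolding undirected_tree_def pair_bidirected_digraph_def
    pair_loopfree_digraph_def pair_loopfree_digraph_axioms_def by fastforce

text \<open>Edge paths without backtracking.\<close>

fun reduced_path :: "'v list \<Rightarrow> bool" where
  "reduced_path [] = False"
| "reduced_path [x] = (x \<in> pverts T)"
| "reduced_path [x, y] = ((x, y) \<in> parcs T)"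
| "reduced_path (x # y # z # zs) = ((x, y) \<in> parcs T \<and> x \<noteq> z \<and> reduced_path (y # z # zs))"

lemma reduced_path_tl: "reduced_path (x # y # zs) \<Longrightarrow> reduced_path (y # zs)"
  by (cases zs) (auto dest: arcs_in_verts)

lemma reduced_path_nonempty: "reduced_path xs \<Longrightarrow> xs \<noteq> []"
  by auto

lemma reduced_path_verts: "reduced_path xs \<Longrightarrow> set xs \<subseteq> pverts T"
  by (induction xs rule: reduced_path.induct) (auto dest: arcs_in_verts)

lemma reduced_path_join:
  assumes "reduced_path (xs @ [x])" "reduced_path (x # ys)"
    and "xs \<noteq> [] \<Longrightarrow> ys \<noteq> [] \<Longrightarrow> last xs \<noteq> hd ys"
  shows "reduced_path (xs @ x # ys)"
  using assms
proof (induction xs)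
  case (Cons a xs)
  show ?case
  proof (cases xs)
    case Nil
    then show ?thesis using Cons.prems by (cases ys) auto
  next
    case (Cons b xs')
    have "reduced_path (xs @ x # ys)"
      using Cons.IH Cons.prems local.Cons by (auto dest: reduced_path_tl)
    moreover have "(a, b) \<in> parcs T" "xs' = [] \<Longrightarrow> a \<noteq> x" "xs' \<noteq> [] \<Longrightarrow> a \<noteq> hd xs'"
      using Cons.prems(1) local.Cons by (cases xs'; auto)+
    ultimately show ?thesis using local.Cons by (cases xs') auto
  qed
qed auto

lemma reduced_path_splitD:
  "reduced_path (xs @ x # ys) \<Longrightarrow> reduced_path (xs @ [x]) \<and> reduced_path (x # ys)"
proof (induction xs)
  case Nil
  then show ?case using reduced_path_verts by fastforce
next
  case (Cons a xs)
  show ?case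
  proof (cases xs)
    case Nil
    then show ?thesis using Cons.prems by (cases ys) (auto dest: arcs_in_verts)
  next
    case (Cons b xs')
    have "reduced_path (xs @ x # ys)"
      using Cons.prems local.Cons by (auto dest: reduced_path_tl)
    then have "reduced_path (xs @ [x]) \<and> reduced_path (x # ys)" using Cons.IH by blast
    moreover have "reduced_path (a # xs @ [x])"
      using Cons.prems calculation local.Cons by (cases xs') auto
    ultimately show ?thesis by auto
  qed
qed

lemma reduced_path_rev: "reduced_path xs \<Longrightarrow> reduced_path (rev xs)"
proof (induction xs rule: reduced_path.induct)
  case (4 x y z zs)
  have "reduced_path (rev zs @ [z, y])" "reduced_path [y, x]"
    using 4 by (auto dest: arcs_sym)
  then show ?case using reduced_path_join[of "rev zs @ [z]" y "[x]"] 4 by auto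
qed (auto dest: arcs_sym)


text \<open>
  A shortest repetition in a path without backtracking is a closed walk of length at least three
  whose vertices are otherwise distinct: a cycle, which a tree does not have.
\<close>

lemma reduced_path_distinct: "reduced_path xs \<Longrightarrow> distinct xs"
proof (induction "length xs" arbitrary: xs rule: less_induct)
  case less
  show ?case
  proof (rule ccontr)
    assume nd: "\<not> distinct xs"
    obtain x xs' where xs: "xs = x # xs'" using less.prems by (cases xs) auto
    have xs'_ne: "xs' \<noteq> []" using nd xs by auto
    have d1: "distinct xs'"
      using less.hyps[of xs'] less.prems xs xs'_ne reduced_path_tl
      by (cases xs') auto
    obtain ys y where ys: "xs' = ys @ [y]" using xs'_ne by (cases xs' rule: rev_cases) auto
    have "reduced_path (x # ys)"
      using less.prems reduced_path_splitD[of "x # ys" y "[]"] unfolding xs ys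
      by (cases ys rule: rev_cases)
        (use reduced_path_verts in fastforce, metis Cons_eq_appendI append.assoc append_Cons append_Nil reduced_path_splitD)
    then have d2: "distinct (x # ys)" using less.hyps[of "x # ys"] xs ys by auto
    have yx: "y = x" using nd d1 d2 unfolding xs ys by auto
    \<comment> \<open>The excluded lengths are a loop and a backtracking.\<close>
    have len: "2 \<le> length ys"
    proof -
      have "ys \<noteq> []" using less.prems no_loop unfolding xs ys yx by auto
      moreover have "length ys \<noteq> 1"
        using less.prems unfolding xs ys yx by (auto simp: length_Suc_conv)
      ultimately show ?thesis by (cases ys rule: remdups_adj.cases) auto
    qed
    define p where "p = zip (x # ys) (ys @ [x])"
    have closed: "set p \<subseteq> parcs T \<and> pcas u p v \<and> pawalk_verts u p = u # zs @ [v]"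
      if "reduced_path (u # zs @ [v])" "p = zip (u # zs) (zs @ [v])" for u v zs p
      using that
    proof (induction zs arbitrary: u p)
      case (Cons z zs)
      let ?p = "zip (z # zs) (zs @ [v])"
      have "reduced_path (z # zs @ [v])" "(u, z) \<in> parcs T"
        using Cons.prems by (cases zs; auto)+
      then show ?case using Cons.IH[of z ?p] Cons.prems by simp
    qed auto
    have c: "set p \<subseteq> parcs T \<and> pcas x p x \<and> pawalk_verts x p = x # ys @ [x]"
      using closed[of x ys x p] less.prems p_def unfolding xs ys yx by simp
    have "pre_digraph.cycle (with_proj T) p"
      unfolding pre_digraph.cycle_def pre_digraph.awalk_def cas_with_proj_eq
        awalk_verts_with_proj_eq with_proj_simps
      using c less.prems reduced_path_verts d1 ys yx len p_def xs by fastforce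
    then have "length p < 3" using is_tree unfolding undirected_tree_def by blast
    then show False using len p_def by simp
  qed
qed

text \<open>
  After their common beginning, two such paths form, one of them run backwards, a path without
  backtracking, and this would return to its starting point.
\<close>

lemma reduced_path_unique:
  "reduced_path (a # ps) \<Longrightarrow> reduced_path (a # qs) \<Longrightarrow> last (a # ps) = last (a # qs) \<Longrightarrow> ps = qs"
proof (induction ps arbitrary: a qs)
  case Nil
  show ?case
  proof (cases "qs = []")
    case False
    then have "a \<in> set qs" using Nil by auto
    then show ?thesis using reduced_path_distinct[OF Nil(2)] by auto
  qed auto
next
  case (Cons x ps)
  show ?case
  proof (cases qs)
    case Nil
    then have "a \<in> set (x # ps)" using Cons.prems by (metis last.simps last_in_set list.discI)
    then show ?thesis using reduced_path_distinct[OF Cons.prems(1)] by auto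
  next
    case (Cons y qs')
    show ?thesis
    proof (cases "x = y")
      case True
      then show ?thesis
        using Cons.IH[of x qs'] Cons.prems local.Cons by (auto dest: reduced_path_tl)
    next
      case False
      have "reduced_path (rev (x # ps) @ [a])"
        using reduced_path_rev[OF Cons.prems(1)] by simp
      then have "reduced_path (rev (x # ps) @ a # qs)"
        by (rule reduced_path_join) (use Cons.prems local.Cons False in auto)
      then have "distinct (rev (x # ps) @ a # qs)" by (rule reduced_path_distinct)
      moreover have "last (x # ps) \<in> set (rev (x # ps))" "last (a # qs) \<in> set (a # qs)"
        by (metis last_in_set list.discI set_rev, metis last_in_set list.discI)
      ultimately show ?thesis using Cons.prems(3) by auto
    qed
  qed
qed

lemma reduced_path_exists:
  assumes "x \<in> pverts T" "y \<in> pverts T"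
  shows "\<exists>p. reduced_path (x # p) \<and> last (x # p) = y"
proof -
  have wf: "wf_digraph (with_proj T)"
    by unfold_locales (auto dest: arcs_in_verts)
  have "symmetric (with_proj T)"
    unfolding symmetric_def by (auto intro: symI arcs_sym)
  moreover have "x \<rightarrow>\<^sup>*\<^bsub>mk_symmetric (with_proj T)\<^esub> y"
    using is_tree assms unfolding undirected_tree_def connected_def strongly_connected_def by auto
  ultimately have "x \<rightarrow>\<^sup>*\<^bsub>with_proj T\<^esub> y"
    using wf_digraph.reachable_mk_symmetric_eq[OF wf] by blast
  then have "(x, y) \<in> rtrancl_on (pverts T) (parcs T)" by (simp add: reachable_def)
  then show ?thesis
  proof (induction rule: rtrancl_on_induct)
    case base
    then show ?case by (intro exI[of _ "[]"]) simp
  next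
    case (step y z)
    then obtain p where p: "reduced_path (x # p)" "last (x # p) = y" by auto
    obtain q where q: "x # p = q @ [y]" using p(2) by (metis append_butlast_last_id list.discI)
    show ?case
    proof (cases "q \<noteq> [] \<and> last q = z")
      case True
      then have q': "q = x # tl q" using q by (cases q) auto
      obtain q2 where "q = q2 @ [z]" using True by (metis append_butlast_last_id)
      then have "reduced_path q" using p(1) q reduced_path_splitD[of q2 z "[y]"] by simp
      then show ?thesis using True q' by metis
    next
      case False
      have "reduced_path (q @ y # [z])"
        by (rule reduced_path_join) (use False p q step in auto)
      then show ?thesis using q by (metis append.assoc append_Cons append_Nil last_snoc)
    qed
  qed
qed

end

lemma common_prefix_decomp:
  "\<exists>zs xs' ys'. xs = zs @ xs' \<and> ys = zs @ ys' \<and> length zs = common_prefix_length xs ys \<and>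
     (xs' = [] \<or> ys' = [] \<or> hd xs' \<noteq> hd ys')"
proof (induction xs ys rule: common_prefix_length.induct)
  case (1 x xs y ys)
  show ?case
  proof (cases "x = y")
    case True
    then obtain zs xs' ys' where "xs = zs @ xs'" "ys = zs @ ys'"
      "length zs = common_prefix_length xs ys" "xs' = [] \<or> ys' = [] \<or> hd xs' \<noteq> hd ys'"
      using 1 by blast
    then show ?thesis using True by (intro exI[of _ "x # zs"] exI[of _ xs'] exI[of _ ys']) auto
  next
    case False
    then show ?thesis
      by (intro exI[of _ "[]"] exI[of _ "x # xs"] exI[of _ "y # ys"]) auto
  qed
qed auto

context tree_graph
begin

definition geodesic :: "'v \<Rightarrow> 'v \<Rightarrow> 'v list" where
  "geodesic x y = (THE p. reduced_path p \<and> hd p = x \<and> last p = y)"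

definition tdist :: "'v \<Rightarrow> 'v \<Rightarrow> int" where
  "tdist x y = int (length (geodesic x y)) - 1"

text \<open>
  Twice the Gromov product \<open>(x|y)\<^sub>z\<close>, that is, twice the length of the common part of the geodesics
  from \<open>z\<close> to \<open>x\<close> and from \<open>z\<close> to \<open>y\<close>.
\<close>

definition gp :: "'v \<Rightarrow> 'v \<Rightarrow> 'v \<Rightarrow> int" where
  "gp z x y = tdist z x + tdist z y - tdist x y"

lemma geodesic_eqI:
  assumes "reduced_path p" "hd p = x" "last p = y"
  shows "geodesic x y = p"
  unfolding geodesic_def
proof (rule the_equality)
  fix q assume q: "reduced_path q \<and> hd q = x \<and> last q = y"
  obtain p' q' where "p = x # p'" "q = x # q'"
    using assms q reduced_path_nonempty by (metis list.collapse)
  then show "q = p" using reduced_path_unique[of x q' p'] assms q by auto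
qed (use assms in auto)

lemma geodesic:
  assumes "x \<in> pverts T" "y \<in> pverts T"
  shows "reduced_path (geodesic x y)" "hd (geodesic x y) = x" "last (geodesic x y) = y"
    "geodesic x y \<noteq> []"
proof -
  obtain p where "reduced_path (x # p)" "last (x # p) = y"
    using reduced_path_exists assms by blast
  then have "geodesic x y = x # p" "reduced_path (x # p)" "last (x # p) = y"
    by (auto intro!: geodesic_eqI)
  then show "reduced_path (geodesic x y)" "hd (geodesic x y) = x" "last (geodesic x y) = y"
    "geodesic x y \<noteq> []" by auto
qed

lemma tdist_eqI:
  assumes "reduced_path p" "hd p = x" "last p = y"
  shows "tdist x y = int (length p) - 1"
  using geodesic_eqI[OF assms] by (simp add: tdist_def)

lemma tdist_nonneg: "x \<in> pverts T \<Longrightarrow> y \<in> pverts T \<Longrightarrow> 0 \<le> tdist x y"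
  using geodesic(4)[of x y] unfolding tdist_def by (cases "geodesic x y") auto

lemma tdist_self [simp]: "x \<in> pverts T \<Longrightarrow> tdist x x = 0"
  by (subst tdist_eqI[of "[x]"]) auto

lemma tdist_zeroD: "x \<in> pverts T \<Longrightarrow> y \<in> pverts T \<Longrightarrow> tdist x y = 0 \<Longrightarrow> x = y"
  using geodesic[of x y] unfolding tdist_def by (cases "geodesic x y") auto

lemma tdist_sym: "x \<in> pverts T \<Longrightarrow> y \<in> pverts T \<Longrightarrow> tdist x y = tdist y x"
  using geodesic[of x y] by (subst tdist_eqI[of "rev (geodesic x y)" y x])
    (auto simp: tdist_def reduced_path_rev hd_rev last_rev)

lemma tdist_oneD: "x \<in> pverts T \<Longrightarrow> y \<in> pverts T \<Longrightarrow> tdist x y = 1 \<Longrightarrow> (x, y) \<in> parcs T"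
  using geodesic[of x y] unfolding tdist_def
  by (cases "geodesic x y" rule: remdups_adj.cases) auto

text \<open>
  Past their common prefix the two geodesics never meet again, since one of them run backwards,
  followed by the other, has no backtracking; so it is the geodesic from \<open>x\<close> to \<open>y\<close>.
\<close>

lemma gp_common_prefix:
  assumes "x \<in> pverts T" "y \<in> pverts T" "z \<in> pverts T"
  shows "gp z x y = 2 * (int (common_prefix_length (geodesic z x) (geodesic z y)) - 1)"
    "common_prefix_length (geodesic z x) (geodesic z y) \<noteq> 0"
proof -
  let ?k = "common_prefix_length (geodesic z x) (geodesic z y)"
  obtain zs xs ys where d: "geodesic z x = zs @ xs" "geodesic z y = zs @ ys" "length zs = ?k"
    "xs = [] \<or> ys = [] \<or> hd xs \<noteq> hd ys" using common_prefix_decomp by meson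
  have "zs \<noteq> []"
    using d geodesic[of z x] geodesic[of z y] assms by auto
  then show "?k \<noteq> 0" using d(3) by (metis length_0_conv)
  obtain us m where zs: "zs = us @ [m]" using \<open>zs \<noteq> []\<close> by (cases zs rule: rev_cases) auto
  have rx: "reduced_path (m # xs)" and ry: "reduced_path (m # ys)"
    using reduced_path_splitD[of us m xs] reduced_path_splitD[of us m ys]
      geodesic(1)[of z x] geodesic(1)[of z y] assms d zs by auto
  have "reduced_path (rev xs @ m # ys)"
    by (rule reduced_path_join) (use d(4) reduced_path_rev[OF rx] ry in \<open>auto simp: last_rev\<close>)
  moreover have "hd (rev xs @ m # ys) = x"
    using geodesic(3)[of z x] assms d(1) zs by (cases xs rule: rev_cases) auto
  moreover have "last (rev xs @ m # ys) = y"
    using geodesic(3)[of z y] assms d(2) zs by auto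
  ultimately have "tdist x y = int (length xs + length ys)" by (subst tdist_eqI) auto
  then show "gp z x y = 2 * (int ?k - 1)"
    using d by (simp add: gp_def tdist_def)
qed

lemma gp_even: "x \<in> pverts T \<Longrightarrow> y \<in> pverts T \<Longrightarrow> z \<in> pverts T \<Longrightarrow> even (gp z x y)"
  by (simp add: gp_common_prefix)

lemma gp_nonneg: "x \<in> pverts T \<Longrightarrow> y \<in> pverts T \<Longrightarrow> z \<in> pverts T \<Longrightarrow> 0 \<le> gp z x y"
  using gp_common_prefix[of x y z] by auto

lemma gp_sym: "x \<in> pverts T \<Longrightarrow> y \<in> pverts T \<Longrightarrow> gp z x y = gp z y x"
  by (simp add: gp_def tdist_sym)

lemma tdist_triangle:
  "x \<in> pverts T \<Longrightarrow> y \<in> pverts T \<Longrightarrow> z \<in> pverts T \<Longrightarrow> tdist x y \<le> tdist x z + tdist z y"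
  using gp_nonneg[of x y z] tdist_sym[of x z] by (simp add: gp_def)

text \<open>
  Trees are \<open>0\<close>-hyperbolic: the Gromov products based at \<open>w\<close> inherit the ultrametric inequality of
  common prefixes of geodesics.
\<close>

lemma gp_hyperbolic:
  assumes "x \<in> pverts T" "y \<in> pverts T" "z \<in> pverts T" "w \<in> pverts T"
  shows "min (gp w x y) (gp w y z) \<le> gp w x z"
proof -
  let ?c = "\<lambda>x y. common_prefix_length (geodesic w x) (geodesic w y)"
  have "min (?c x y) (?c y z) \<le> ?c x z" by (rule common_prefix_length_ultrametric)
  then have "min (int (?c x y)) (int (?c y z)) \<le> int (?c x z)" by linarith
  then show ?thesis using gp_common_prefix(1) assms by (simp add: min_def split: if_splits)
qed

definition between :: "'v \<Rightarrow> 'v \<Rightarrow> 'v \<Rightarrow> bool" where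
  "between x w y \<longleftrightarrow> tdist x w + tdist w y = tdist x y"

lemma between_exists:
  assumes "x \<in> pverts T" "y \<in> pverts T" "0 \<le> k" "k \<le> tdist x y"
  shows "\<exists>w\<in>pverts T. tdist x w = k \<and> between x w y"
proof -
  let ?p = "geodesic x y"
  let ?k = "nat k"
  have k: "?k < length ?p" using assms unfolding tdist_def by auto
  have dec: "?p = take ?k ?p @ ?p ! ?k # drop (Suc ?k) ?p" using k by (rule id_take_nth_drop)
  have p: "reduced_path ?p" "hd ?p = x" "last ?p = y" using geodesic assms by auto
  have r: "reduced_path (take ?k ?p @ [?p ! ?k])" "reduced_path (?p ! ?k # drop (Suc ?k) ?p)"
    using reduced_path_splitD[of "take ?k ?p" "?p ! ?k" "drop (Suc ?k) ?p"] dec p(1) by auto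
  have "hd (take ?k ?p @ [?p ! ?k]) = x"
    using p(2) k by (cases "?k = 0") (auto simp: hd_append hd_conv_nth)
  then have "tdist x (?p ! ?k) = int ?k"
    using k by (subst tdist_eqI[OF r(1)]) auto
  moreover have "last (?p ! ?k # drop (Suc ?k) ?p) = y"
    using p(3) k by (simp add: last_drop Cons_nth_drop_Suc)
  then have "tdist (?p ! ?k) y = tdist x y - int ?k"
    using k by (subst tdist_eqI[OF r(2)]) (auto simp: tdist_def)
  moreover have "?p ! ?k \<in> pverts T"
    using reduced_path_verts[OF r(2)] by auto
  ultimately show ?thesis using assms(3) by (auto simp: between_def)
qed

lemma gp_between: 
  "x \<in> pverts T \<Longrightarrow> y \<in> pverts T \<Longrightarrow> w \<in> pverts T \<Longrightarrow> between x w y \<Longrightarrow> gp x w y = 2 * tdist x w"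
  by (simp add: gp_def between_def)

text \<open>
  All overlaps of geodesics are bounded in this way: it suffices to exhibit two different vertices,
  one on each geodesic, at the same distance \<open>k\<close> from the starting point.
\<close>

lemma gp_less:
  assumes V: "z \<in> pverts T" "x \<in> pverts T" "y \<in> pverts T" "x' \<in> pverts T" "y' \<in> pverts T"
    and "between z x' x" "between z y' y" "tdist z x' = k" "tdist z y' = k" "x' \<noteq> y'"
  shows "gp z x y < 2 * k"
proof (rule ccontr)
  assume "\<not> gp z x y < 2 * k"
  moreover have "gp z x' x = 2 * k" "gp z y y' = 2 * k"
    using gp_between[of z x x'] gp_between[of z y y'] gp_sym[of y y' z] assms by auto
  ultimately have "2 * k \<le> gp z x' y'"
    using gp_hyperbolic[of x' x y z] gp_hyperbolic[of x' y y' z] V by linarith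
  then have "tdist x' y' \<le> 0" using assms by (simp add: gp_def)
  then have "tdist x' y' = 0" using tdist_nonneg V by (simp add: order_antisym)
  then show False using tdist_zeroD V assms by blast
qed

lemma between_trans:
  assumes "a \<in> pverts T" "b \<in> pverts T" "c \<in> pverts T" "d \<in> pverts T"
    and "between a b c" "between a c d"
  shows "between a b d"
  using assms tdist_triangle[of a d b] tdist_triangle[of b d c] unfolding between_def by linarith

lemma between_sym:
  "a \<in> pverts T \<Longrightarrow> b \<in> pverts T \<Longrightarrow> c \<in> pverts T \<Longrightarrow> between a b c \<Longrightarrow> between c b a"
  using tdist_sym unfolding between_def by (metis add.commute)

lemma tdist_between:
  assumes V: "x \<in> pverts T" "y \<in> pverts T" "w \<in> pverts T" "w' \<in> pverts T"
    and "between x w y" "between x w' y"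
  shows "tdist w w' = \<bar>tdist x w - tdist x w'\<bar>"
proof -
  have "gp x w y = 2 * tdist x w" "gp x y w' = 2 * tdist x w'"
    using gp_between[of x y w] gp_between[of x y w'] gp_sym[of y w' x] assms by auto
  then have "2 * min (tdist x w) (tdist x w') \<le> gp x w w'"
    using gp_hyperbolic[of w y w' x] V by linarith
  then have "tdist w w' \<le> \<bar>tdist x w - tdist x w'\<bar>" unfolding gp_def by linarith
  then show ?thesis
    using tdist_triangle[of x w w'] tdist_triangle[of x w' w] tdist_sym[of w w'] V by linarith
qed

text \<open>
  A bi-infinite walk that never turns back on the spot is a geodesic line, because its finite pieces
  are reduced paths.
\<close>

lemma line_tdist:
  fixes X :: "int \<Rightarrow> 'v"
  assumes V: "\<And>i. X i \<in> pverts T" and one: "\<And>i. tdist (X i) (X (i + 1)) = 1"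
    and red: "\<And>i. X i \<noteq> X (i + 2)"
  shows "tdist (X i) (X j) = \<bar>i - j\<bar>"
proof -
  have arcs: "(X i, X (i + 1)) \<in> parcs T" for i using tdist_oneD V one by blast
  have r: "reduced_path (map (\<lambda>k. X (i + int k)) [0..<Suc n])" for i n
  proof (induction n arbitrary: i)
    case (Suc n)
    have s: "map (\<lambda>k. X (i + int k)) [0..<Suc m] =
        X i # map (\<lambda>k. X ((i + 1) + int k)) [0..<m]" for i m
      by (simp add: map_upt_Suc algebra_simps del: upt_Suc)
    show ?case
    proof (cases n)
      case 0
      then show ?thesis using arcs[of i] V by (auto simp: ac_simps)
    next
      case (Suc n')
      then show ?thesis
        using Suc.IH[of "i + 1"] arcs[of i] red[of i] by (simp add: s add.commute[of 2 i] del: upt_Suc)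
    qed
  qed (use V in auto)
  have tdist: "tdist (X i) (X (i + int n)) = int n" for i n
    using r[of i n] by (subst tdist_eqI[OF r[of i n]]) (auto simp del: upt_Suc simp: hd_map last_map)
  show ?thesis
  proof (cases "i \<le> j")
    case True
    then show ?thesis using tdist[of i "nat (j - i)"] by simp
  next
    case False
    then show ?thesis using tdist[of j "nat (i - j)"] tdist_sym[of "X i" "X j"] V by simp
  qed
qed

lemma reduced_path_map:
  assumes "inj_on f (pverts T)" "\<And>x. x \<in> pverts T \<Longrightarrow> f x \<in> pverts T"
    "\<And>x y. (x, y) \<in> parcs T \<Longrightarrow> (f x, f y) \<in> parcs T"
  shows "reduced_path p \<Longrightarrow> reduced_path (map f p)"
proof (induction p rule: reduced_path.induct)
  case (4 x y z zs)
  then have "x \<in> pverts T" "z \<in> pverts T" using reduced_path_verts by fastforce+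
  then have "f x \<noteq> f z" using 4 inj_onD[OF assms(1)] by auto
  then show ?case using 4 assms(3) by simp
qed (use assms in auto)

lemma tdist_isometry:
  assumes "inj_on f (pverts T)" "\<And>x. x \<in> pverts T \<Longrightarrow> f x \<in> pverts T"
    "\<And>x y. (x, y) \<in> parcs T \<Longrightarrow> (f x, f y) \<in> parcs T"
    and V: "x \<in> pverts T" "y \<in> pverts T"
  shows "tdist (f x) (f y) = tdist x y"
  using geodesic[OF V] reduced_path_map[OF assms(1-3), of "geodesic x y"]
  by (subst tdist_eqI[of "map f (geodesic x y)"]) (auto simp: tdist_def hd_map last_map)

end

section \<open>Elliptic elements and the modular homomorphism\<close>

context group
begin

lemma inv_cancel_left:
  "x \<in> carrier G \<Longrightarrow> y \<in> carrier G \<Longrightarrow> inv x \<otimes> (x \<otimes> y) = y"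
  "x \<in> carrier G \<Longrightarrow> y \<in> carrier G \<Longrightarrow> x \<otimes> (inv x \<otimes> y) = y"
  by (simp_all flip: m_assoc)

lemma conj_int_pow:
  assumes "g \<in> carrier G" "a \<in> carrier G"
  shows "g \<otimes> (a [^] (k::int)) \<otimes> inv g = (g \<otimes> a \<otimes> inv g) [^] k"
proof -
  have "(g \<otimes> x \<otimes> inv g) \<otimes> (g \<otimes> y \<otimes> inv g) = g \<otimes> (x \<otimes> y) \<otimes> inv g"
    if "x \<in> carrier G" "y \<in> carrier G" for x y
    using that assms(1) by (simp add: m_assoc inv_cancel_left)
  then interpret c: group_hom G G "\<lambda>a. g \<otimes> a \<otimes> inv g"
    using assms(1) by unfold_locales (auto simp: hom_def)
  show ?thesis using c.hom_int_pow[OF assms(2)] by simp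
qed

lemma infinite_cyclic_generator:
  assumes "infinite_cyclic_subgroup H G"
  obtains b where "b \<in> carrier G" "H = range (\<lambda>k::int. b [^] k)" "\<And>k::int. b [^] k = \<one> \<longleftrightarrow> k = 0"
proof -
  have H: "subgroup H G" and iso: "G\<lparr>carrier := H\<rparr> \<cong> integer_group"
    using assms by (auto simp: infinite_cyclic_subgroup_def)
  have "integer_group \<cong> G\<lparr>carrier := H\<rparr>"
    using group.iso_sym[OF subgroup.subgroup_is_group[OF H is_group] iso] .
  then obtain h where h: "h \<in> iso integer_group (G\<lparr>carrier := H\<rparr>)" by (auto simp: is_iso_def)
  have "h \<in> hom integer_group G"
    using h subgroup.subset[OF H] by (auto simp: iso_def hom_def Pi_iff)
  then interpret h: group_hom integer_group G h
    by (simp add: group_hom_def group_hom_axioms_def is_group)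
  have pow: "h k = h 1 [^] k" for k :: int
    using h.hom_int_pow[of 1 k] by simp
  have bij: "bij_betw h UNIV H" using h by (auto simp: iso_def)
  show ?thesis
  proof
    show "h 1 \<in> carrier G" by simp
    show "H = range (\<lambda>k::int. h 1 [^] k)"
      using bij pow by (metis (no_types, lifting) bij_betw_imp_surj_on image_cong)
    show "h 1 [^] k = \<one> \<longleftrightarrow> k = 0" for k :: int
      using bij pow h.hom_one unfolding bij_betw_def inj_on_def
      by (metis UNIV_I one_integer_group)
  qed
qed

lemma int_pow_inj:
  assumes "b \<in> carrier G" "\<And>k::int. b [^] k = \<one> \<Longrightarrow> k = 0" "b [^] (i::int) = b [^] j"
  shows "i = j"
proof -
  have "b [^] (i - j) = \<one>" using assms by (simp add: int_pow_diff)
  then show ?thesis using assms(2) by fastforce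
qed

end

sublocale GBS_action \<subseteq> group G
  using group_hom group_hom.axioms(1) by auto

sublocale GBS_action \<subseteq> tree_graph T
  by unfold_locales (rule tree)

context GBS_action
begin

lemma act_closed [simp]: "g \<in> carrier G \<Longrightarrow> x \<in> pverts T \<Longrightarrow> \<phi> g x \<in> pverts T"
  using element_image by blast

lemma act_one [simp]: "x \<in> pverts T \<Longrightarrow> \<phi> \<one> x = x"
  using id_eq_one by (metis restrict_apply')

lemma act_mult: "g \<in> carrier G \<Longrightarrow> h \<in> carrier G \<Longrightarrow> x \<in> pverts T \<Longrightarrow> \<phi> (g \<otimes> h) x = \<phi> g (\<phi> h x)"
  by (rule composition_rule)

lemma act_inv_left [simp]: "g \<in> carrier G \<Longrightarrow> x \<in> pverts T \<Longrightarrow> \<phi> (inv g) (\<phi> g x) = x"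
  by (simp flip: act_mult)

lemma act_inv_right [simp]: "g \<in> carrier G \<Longrightarrow> x \<in> pverts T \<Longrightarrow> \<phi> g (\<phi> (inv g) x) = x"
  by (simp flip: act_mult)

lemma act_eq_iff:
  "g \<in> carrier G \<Longrightarrow> x \<in> pverts T \<Longrightarrow> y \<in> pverts T \<Longrightarrow> \<phi> g x = \<phi> g y \<longleftrightarrow> x = y"
  by (metis act_inv_left)

lemma act_tdist [simp]:
  "g \<in> carrier G \<Longrightarrow> x \<in> pverts T \<Longrightarrow> y \<in> pverts T \<Longrightarrow> tdist (\<phi> g x) (\<phi> g y) = tdist x y"
  using tdist_isometry[of "\<phi> g"] inj_prop preserves_edges by auto

lemma act_gp [simp]:
  "g \<in> carrier G \<Longrightarrow> x \<in> pverts T \<Longrightarrow> y \<in> pverts T \<Longrightarrow> z \<in> pverts T \<Longrightarrow>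
    gp (\<phi> g z) (\<phi> g x) (\<phi> g y) = gp z x y"
  by (simp add: gp_def)

lemma act_between [simp]:
  "g \<in> carrier G \<Longrightarrow> x \<in> pverts T \<Longrightarrow> y \<in> pverts T \<Longrightarrow> z \<in> pverts T \<Longrightarrow>
    between (\<phi> g x) (\<phi> g z) (\<phi> g y) = between x z y"
  by (simp add: between_def)

abbreviation stab :: "'v \<Rightarrow> 'g set" where
  "stab x \<equiv> stabilizer G \<phi> x"

lemma stab_iff: "a \<in> stab x \<longleftrightarrow> a \<in> carrier G \<and> \<phi> a x = x"
  by (simp add: stabilizer_def)

lemma stab_subgroup: "x \<in> pverts T \<Longrightarrow> subgroup (stab x) G"
  using vertex_stabilizers by (simp add: infinite_cyclic_subgroup_def)

lemma stab_mult: "x \<in> pverts T \<Longrightarrow> a \<in> stab x \<Longrightarrow> b \<in> stab x \<Longrightarrow> a \<otimes> b \<in> stab x"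
  by (rule subgroup.m_closed[OF stab_subgroup])

lemma stab_inv: "x \<in> pverts T \<Longrightarrow> a \<in> stab x \<Longrightarrow> inv a \<in> stab x"
  by (rule subgroup.m_inv_closed[OF stab_subgroup])

lemma stab_pow: "x \<in> pverts T \<Longrightarrow> a \<in> stab x \<Longrightarrow> a [^] (k::int) \<in> stab x"
  by (rule subgroup_int_pow_closed[OF stab_subgroup])

lemma stab_conj:
  assumes "x \<in> pverts T" "g \<in> carrier G" "a \<in> carrier G"
  shows "g \<otimes> a \<otimes> inv g \<in> stab (\<phi> g x) \<longleftrightarrow> a \<in> stab x"
  using assms by (simp add: stab_iff act_mult act_eq_iff)

lemma stab_conj_inv:
  assumes "x \<in> pverts T" "g \<in> carrier G" "a \<in> carrier G"
  shows "inv g \<otimes> a \<otimes> g \<in> stab x \<longleftrightarrow> a \<in> stab (\<phi> g x)"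
  using assms by (auto simp: stab_iff act_mult) (metis act_closed act_inv_right)

text \<open>
  A vertex between \<open>x\<close> and \<open>y\<close> is determined by its distance from \<open>x\<close>, which an element fixing \<open>x\<close>
  and \<open>y\<close> preserves.
\<close>

lemma stab_between:
  assumes "x \<in> pverts T" "y \<in> pverts T" "w \<in> pverts T" "between x w y"
    and "a \<in> stab x" "a \<in> stab y"
  shows "a \<in> stab w"
proof -
  have a: "a \<in> carrier G" "\<phi> a x = x" "\<phi> a y = y" using assms by (auto simp: stab_iff)
  have "between x (\<phi> a w) y" "tdist x (\<phi> a w) = tdist x w"
    using act_between[of a x y w] act_tdist[of a x w] a assms by auto
  then have "tdist w (\<phi> a w) = 0" using tdist_between[of x y w "\<phi> a w"] assms a by simp
  then show ?thesis using tdist_zeroD[of w "\<phi> a w"] a assms by (auto simp: stab_iff)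
qed

lemma stab_generator:
  assumes "x \<in> pverts T"
  obtains b where "b \<in> carrier G" "stab x = range (\<lambda>k::int. b [^] k)" "\<And>k::int. b [^] k = \<one> \<longleftrightarrow> k = 0"
  using infinite_cyclic_generator[OF vertex_stabilizers[OF assms]] by blast

lemma elliptic_iff: "elliptic G T \<phi> a \<longleftrightarrow> (\<exists>x\<in>pverts T. a \<in> stab x)"
  by (auto simp: elliptic_def stab_iff)

lemma elliptic_torsion_free:
  assumes "elliptic G T \<phi> a" "a \<noteq> \<one>" "a [^] (k::int) = \<one>"
  shows "k = 0"
proof -
  obtain x where x: "x \<in> pverts T" "a \<in> stab x" using assms by (auto simp: elliptic_iff)
  obtain b where b: "b \<in> carrier G" "stab x = range (\<lambda>k::int. b [^] k)"
    "\<And>k::int. b [^] k = \<one> \<longleftrightarrow> k = 0" using stab_generator[OF x(1)] by blast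
  obtain j :: int where j: "a = b [^] j" using x b by auto
  then have "b [^] (j * k) = \<one>" using assms b(1) by (simp add: int_pow_pow)
  then have "j * k = 0" using b(3) by blast
  moreover have "j \<noteq> 0" using j assms(2) by auto
  ultimately show ?thesis by simp
qed

text \<open>Adjacent stabilizers share an infinite cyclic group, so all of them are commensurable.\<close>

lemma elliptic_commensurable_aux:
  assumes "x \<in> pverts T" "y \<in> pverts T" "a \<in> stab x" "b \<in> stab y" "a \<noteq> \<one>" "b \<noteq> \<one>"
    and "tdist x y = int n"
  shows "\<exists>(i::int) (j::int). i \<noteq> 0 \<and> j \<noteq> 0 \<and> a [^] i = b [^] j"
proof -
  have same: "\<exists>(i::int) (j::int). i \<noteq> 0 \<and> j \<noteq> 0 \<and> a [^] i = b [^] j"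
    if h: "x \<in> pverts T" "a \<in> stab x" "b \<in> stab x" "a \<noteq> \<one>" "b \<noteq> \<one>" for x a b
  proof -
    obtain c where c: "c \<in> carrier G" "stab x = range (\<lambda>k::int. c [^] k)"
      using stab_generator[OF h(1)] by metis
    obtain i j :: int where ij: "a = c [^] i" "b = c [^] j" using h c by auto
    then have "a [^] j = b [^] i" using c by (simp add: int_pow_pow mult.commute)
    moreover have "i \<noteq> 0" "j \<noteq> 0" using ij h by auto
    ultimately show ?thesis by metis
  qed
  show ?thesis
    using assms
  proof (induction n arbitrary: x a)
    case 0
    then have "x = y" using tdist_zeroD by simp
    then show ?case using same[of y a b] 0 by simp
  next
    case (Suc n)
    obtain z where z: "z \<in> pverts T" "tdist x z = 1" "between x z y"
      using between_exists[of x y 1] Suc.prems by auto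
    have "(x, z) \<in> parcs T" using tdist_oneD z Suc.prems by blast
    then have inf: "infinite_cyclic_subgroup (stab x \<inter> stab z) G" by (rule edge_stabilizers)
    obtain e where e: "e \<in> carrier G" "stab x \<inter> stab z = range (\<lambda>k::int. e [^] k)"
      "\<And>k::int. e [^] k = \<one> \<longleftrightarrow> k = 0" using infinite_cyclic_generator[OF inf] by blast
    have e1: "e \<in> stab x" "e \<in> stab z" using e(1,2) by (metis IntE int_pow_1 rangeI)+
    have e2: "e \<noteq> \<one>" using e(3)[of 1] e(1) by auto
    obtain i j :: int where ij: "i \<noteq> 0" "j \<noteq> 0" "a [^] i = e [^] j"
      using same[OF Suc.prems(1) Suc.prems(3) e1(1) Suc.prems(5) e2] by metis
    have "tdist z y = int n" using z Suc.prems unfolding between_def by simp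
    then obtain k l :: int where kl: "k \<noteq> 0" "l \<noteq> 0" "e [^] k = b [^] l"
      using Suc.IH[OF z(1) Suc.prems(2) e1(2) Suc.prems(4) e2 Suc.prems(6)] by metis
    have car: "a \<in> carrier G" "b \<in> carrier G" using Suc.prems by (auto simp: stab_iff)
    have "a [^] (i * k) = (e [^] j) [^] k"
      using ij car by (simp flip: int_pow_pow)
    also have "\<dots> = (e [^] k) [^] j"
      using e(1) by (simp add: int_pow_pow mult.commute)
    also have "\<dots> = b [^] (l * j)" using kl car by (simp add: int_pow_pow)
    finally show ?case using ij kl by (intro exI[of _ "i * k"] exI[of _ "l * j"]) auto
  qed
qed

lemma elliptic_commensurable:
  assumes "elliptic G T \<phi> a" "elliptic G T \<phi> b" "a \<noteq> \<one>" "b \<noteq> \<one>"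
  shows "\<exists>(i::int) (j::int). i \<noteq> 0 \<and> j \<noteq> 0 \<and> a [^] i = b [^] j"
proof -
  obtain x y where "x \<in> pverts T" "y \<in> pverts T" "a \<in> stab x" "b \<in> stab y"
    using assms by (auto simp: elliptic_iff)
  then show ?thesis
    using elliptic_commensurable_aux[of x y a b "nat (tdist x y)"] assms tdist_nonneg by simp
qed

lemma elliptic_conj:
  assumes "elliptic G T \<phi> a" "g \<in> carrier G"
  shows "elliptic G T \<phi> (g \<otimes> a \<otimes> inv g)"
proof -
  obtain x where x: "x \<in> pverts T" "a \<in> stab x" using assms by (auto simp: elliptic_iff)
  then have "g \<otimes> a \<otimes> inv g \<in> stab (\<phi> g x)"
    using stab_conj[of x g a] assms by (auto simp: stab_iff)
  then show ?thesis using x assms by (auto simp: elliptic_iff)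
qed

lemma elliptic_carrier: "elliptic G T \<phi> a \<Longrightarrow> a \<in> carrier G"
  by (simp add: elliptic_def)

lemma nontrivial_elliptic_exists: "\<exists>a. elliptic G T \<phi> a \<and> a \<noteq> \<one>"
proof -
  obtain x where x: "x \<in> pverts T"
    using tree by (auto simp: undirected_tree_def connected_def strongly_connected_def)
  obtain b where b: "b \<in> carrier G" "stab x = range (\<lambda>k::int. b [^] k)"
    "\<And>k::int. b [^] k = \<one> \<longleftrightarrow> k = 0" using stab_generator[OF x] by blast
  have "b \<in> stab x" using b(1,2) by (metis int_pow_1 rangeI)
  moreover have "b \<noteq> \<one>" using b(3)[of 1] b(1) by auto
  ultimately show ?thesis using x by (auto simp: elliptic_iff)
qed

text \<open>
  Powers of \<open>a\<close> and of \<open>b\<close> agree in some \<open>e \<noteq> 1\<close>, and conjugation by \<open>g\<close> takes \<open>e\<^bsup>m m'\<^esup>\<close> both to \<open>e\<^bsup>n m'\<^esup>\<close>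
  and to \<open>e\<^bsup>n' m\<^esup>\<close>. This makes the definite description in the modular homomorphism meaningful.
\<close>

lemma modular_ratio_unique:
  assumes g: "g \<in> carrier G"
    and a: "elliptic G T \<phi> a" "a \<noteq> \<one>" "g \<otimes> (a [^] (m::int)) \<otimes> inv g = a [^] (n::int)"
    and b: "elliptic G T \<phi> b" "b \<noteq> \<one>" "g \<otimes> (b [^] (m'::int)) \<otimes> inv g = b [^] (n'::int)"
  shows "m * n' = m' * n"
proof -
  obtain i j :: int where ij: "i \<noteq> 0" "j \<noteq> 0" "a [^] i = b [^] j"
    using elliptic_commensurable[OF a(1) b(1) a(2) b(2)] by metis
  note car = elliptic_carrier[OF a(1)] elliptic_carrier[OF b(1)] g
  define e where "e = a [^] i"
  have e: "e \<in> carrier G" "e = b [^] j" using car ij by (auto simp: e_def)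
  have 1: "g \<otimes> e [^] m \<otimes> inv g = e [^] n"
  proof -
    have "e [^] m = (a [^] m) [^] i" "e [^] n = (a [^] n) [^] i"
      using car unfolding e_def by (simp_all add: int_pow_pow mult.commute)
    then show ?thesis using conj_int_pow[of g "a [^] m" i] car a(3) by simp
  qed
  have 2: "g \<otimes> e [^] m' \<otimes> inv g = e [^] n'"
  proof -
    have "e [^] m' = (b [^] m') [^] j" "e [^] n' = (b [^] n') [^] j"
      using car unfolding e(2) by (simp_all add: int_pow_pow mult.commute)
    then show ?thesis using conj_int_pow[of g "b [^] m'" j] car b(3) by simp
  qed
  have "e [^] (n * m') = g \<otimes> e [^] (m * m') \<otimes> inv g"
    using 1 conj_int_pow[of g "e [^] m" m'] e(1) car by (simp add: int_pow_pow)
  also have "\<dots> = e [^] (n' * m)"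
    using 2 conj_int_pow[of g "e [^] m'" m] e(1) car by (simp add: int_pow_pow mult.commute)
  finally have "a [^] (i * (n * m')) = a [^] (i * (n' * m))"
    using car by (simp add: e_def int_pow_pow)
  then have "i * (n * m') = i * (n' * m)"
    using int_pow_inj[OF car(1)] elliptic_torsion_free[OF a(1,2)] by blast
  then show ?thesis using ij by (simp add: mult.commute)
qed

lemma modular_ratio_exists:
  assumes g: "g \<in> carrier G" and a: "elliptic G T \<phi> a" "a \<noteq> \<one>"
  shows "\<exists>(m::int) (n::int). m \<noteq> 0 \<and> n \<noteq> 0 \<and> g \<otimes> (a [^] m) \<otimes> inv g = a [^] n"
proof -
  have "g \<otimes> a \<otimes> inv g \<noteq> \<one>"
  proof
    assume "g \<otimes> a \<otimes> inv g = \<one>"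
    then have "inv g \<otimes> (g \<otimes> a \<otimes> inv g) \<otimes> g = \<one>" using g by simp
    then show False
      using a g elliptic_carrier[OF a(1)] by (simp add: m_assoc inv_cancel_left)
  qed
  then obtain i j :: int where "i \<noteq> 0" "j \<noteq> 0" "(g \<otimes> a \<otimes> inv g) [^] i = a [^] j"
    using elliptic_commensurable[OF elliptic_conj[OF a(1) g] a(1) _ a(2)] by metis
  then show ?thesis using conj_int_pow[OF g elliptic_carrier[OF a(1)]] by metis
qed

lemma modular_hom_eqI:
  assumes g: "g \<in> carrier G" and a: "elliptic G T \<phi> a" "a \<noteq> \<one>" "m \<noteq> 0" "n \<noteq> 0"
    "g \<otimes> (a [^] (m::int)) \<otimes> inv g = a [^] (n::int)"
  shows "modular_hom G T \<phi> g = of_int m / of_int n"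
  unfolding modular_hom_def
proof (rule the_equality)
  fix q
  assume "\<exists>a (m::int) (n::int). elliptic G T \<phi> a \<and> a \<noteq> \<one> \<and> m \<noteq> 0 \<and> n \<noteq> 0 \<and>
      g \<otimes> a [^] m \<otimes> inv g = a [^] n \<and> q = rat_of_int m / rat_of_int n"
  then obtain b m' n' where b: "elliptic G T \<phi> b" "b \<noteq> \<one>" "m' \<noteq> 0" "n' \<noteq> 0"
    "g \<otimes> (b [^] (m'::int)) \<otimes> inv g = b [^] (n'::int)" and q: "q = rat_of_int m' / rat_of_int n'"
    by blast
  have "m * n' = m' * n" using modular_ratio_unique[OF g a(1,2,5) b(1,2,5)] .
  then have "rat_of_int m * rat_of_int n' = rat_of_int m' * rat_of_int n" by (metis of_int_mult)
  then show "q = rat_of_int m / rat_of_int n" using q a b by (simp add: frac_eq_eq)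
qed (use a in blast)

lemma modular_hom_witness:
  assumes "g \<in> carrier G" "elliptic G T \<phi> a" "a \<noteq> \<one>"
  obtains m n :: int where "m \<noteq> 0" "n \<noteq> 0" "g \<otimes> (a [^] m) \<otimes> inv g = a [^] n"
    "modular_hom G T \<phi> g = of_int m / of_int n"
  using modular_ratio_exists[OF assms] modular_hom_eqI[OF assms] that by metis

lemma modular_hom_mult:
  assumes "g \<in> carrier G" "h \<in> carrier G"
  shows "modular_hom G T \<phi> (g \<otimes> h) = modular_hom G T \<phi> g * modular_hom G T \<phi> h"
proof -
  obtain a where a: "elliptic G T \<phi> a" "a \<noteq> \<one>" using nontrivial_elliptic_exists by blast
  note car = elliptic_carrier[OF a(1)] assms
  obtain m n :: int where mn: "m \<noteq> 0" "n \<noteq> 0" "g \<otimes> (a [^] m) \<otimes> inv g = a [^] n"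
    "modular_hom G T \<phi> g = of_int m / of_int n" using modular_hom_witness[OF assms(1) a] .
  obtain k l :: int where kl: "k \<noteq> 0" "l \<noteq> 0" "h \<otimes> (a [^] k) \<otimes> inv h = a [^] l"
    "modular_hom G T \<phi> h = of_int k / of_int l" using modular_hom_witness[OF assms(2) a] .
  have "(g \<otimes> h) \<otimes> a [^] (k * m) \<otimes> inv (g \<otimes> h) = g \<otimes> (h \<otimes> (a [^] k) [^] m \<otimes> inv h) \<otimes> inv g"
    using car by (simp add: inv_mult_group m_assoc int_pow_pow)
  also have "\<dots> = g \<otimes> (a [^] m) [^] l \<otimes> inv g"
    using conj_int_pow[of h "a [^] k" m] kl car by (simp add: int_pow_pow mult.commute)
  also have "\<dots> = a [^] (n * l)"
    using conj_int_pow[of g "a [^] m" l] mn car by (simp add: int_pow_pow)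
  finally have "modular_hom G T \<phi> (g \<otimes> h) = of_int (k * m) / of_int (n * l)"
    using a mn kl car by (intro modular_hom_eqI[of _ a]) auto
  then show ?thesis using mn kl by simp
qed

text \<open>
  An elliptic element commutes with a generator of the stabilizer it lies in.
\<close>

lemma modular_hom_elliptic:
  assumes "elliptic G T \<phi> g"
  shows "modular_hom G T \<phi> g = 1"
proof -
  obtain x where x: "x \<in> pverts T" "g \<in> stab x" using assms by (auto simp: elliptic_iff)
  obtain b where b: "b \<in> carrier G" "stab x = range (\<lambda>k::int. b [^] k)"
    "\<And>k::int. b [^] k = \<one> \<longleftrightarrow> k = 0" using stab_generator[OF x(1)] by blast
  obtain i :: int where i: "g = b [^] i" using x b by auto
  have bs: "b \<in> stab x" using b(1,2) by (metis int_pow_1 rangeI)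
  have b1: "b \<noteq> \<one>" using b(3)[of 1] b(1) by auto
  have "g \<otimes> b = b \<otimes> g"
    using b(1) int_pow_mult[of b i 1] int_pow_mult[of b 1 i] unfolding i by (simp add: add.commute)
  then have "g \<otimes> b [^] (1::int) \<otimes> inv g = b [^] (1::int)"
    using b(1) i by (simp add: m_assoc)
  then show ?thesis
    using modular_hom_eqI[of g b 1 1] bs b1 x assms elliptic_carrier
    by (metis elliptic_iff div_by_1 of_int_1 one_neq_zero)
qed

lemma modular_hom_one: "modular_hom G T \<phi> \<one> = 1"
proof -
  obtain x where "x \<in> pverts T"
    using tree by (auto simp: undirected_tree_def connected_def strongly_connected_def)
  then show ?thesis by (intro modular_hom_elliptic) (auto simp: elliptic_def)
qed

lemma modular_hom_nonzero: "g \<in> carrier G \<Longrightarrow> modular_hom G T \<phi> g \<noteq> 0"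
  using modular_hom_mult[of g "inv g"] modular_hom_one by auto

lemma modular_hom_inv: "g \<in> carrier G \<Longrightarrow> modular_hom G T \<phi> (inv g) = inverse (modular_hom G T \<phi> g)"
  using modular_hom_mult[of g "inv g"] modular_hom_one by (simp add: inverse_unique)

lemma modular_hom_pow:
  assumes "g \<in> carrier G"
  shows "modular_hom G T \<phi> (g [^] (k::int)) = modular_hom G T \<phi> g powi k"
proof -
  have nat: "modular_hom G T \<phi> (g [^] (n::nat)) = modular_hom G T \<phi> g ^ n" for n
    by (induction n) (simp_all add: modular_hom_one modular_hom_mult assms)
  show ?thesis
  proof (cases "k \<ge> 0")
    case True
    then show ?thesis using nat[of "nat k"] int_pow_int[of G g "nat k"] by (simp add: power_int_def)
  next
    case False
    then have "g [^] k = inv (g [^] nat (- k))" by (simp only: int_pow_def2 if_True not_le)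
    moreover have "modular_hom G T \<phi> (inv (g [^] nat (- k))) = inverse (modular_hom G T \<phi> g ^ nat (- k))"
      using modular_hom_inv nat assms nat_pow_closed by metis
    ultimately show ?thesis using False by (simp only: power_int_def power_inverse if_False)
  qed
qed

end

section \<open>Axes of hyperbolic elements\<close>

lemma no_integral_power:
  fixes m n j k :: int
  assumes "coprime m n" "\<bar>m\<bar> \<ge> 2" "\<bar>n\<bar> \<ge> 2"
    and eq: "(of_int m / of_int n :: rat) powi k = of_int j"
  shows "k = 0"
proof (rule ccontr)
  assume "k \<noteq> 0"
  have aux: False if "coprime a b" "\<bar>b\<bar> \<ge> 2" "(of_int a / of_int b :: rat) ^ l = of_int j" "l > 0"
    for a b :: int and l :: nat
  proof -
    have "rat_of_int (a ^ l) = of_int (j * b ^ l)"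
      using that by (simp add: power_divide field_simps)
    then have "a ^ l = j * b ^ l" by (simp only: of_int_eq_iff)
    then have "b dvd a ^ l" using that(4) by (metis dvd_mult dvd_power)
    moreover have "coprime b (a ^ l)" using that(1) by (simp add: coprime_commute)
    ultimately have "is_unit b" by (metis coprime_absorb_left)
    then show False using that(2) by (simp add: zdvd1_eq)
  qed
  show False
  proof (cases "k > 0")
    case True
    then show False using aux[of m n "nat k"] assms by (simp add: power_int_def)
  next
    case False
    then have "(of_int n / of_int m :: rat) ^ nat (- k) = of_int j"
      using eq \<open>k \<noteq> 0\<close> by (simp add: power_int_def)
    then show False using aux[of n m "nat (- k)"] assms False \<open>k \<noteq> 0\<close> by (simp add: coprime_commute)
  qed
qed

context GBS_action
begin

definition axis :: "'g \<Rightarrow> int \<Rightarrow> (int \<Rightarrow> 'v) \<Rightarrow> bool" where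
  "axis g L X \<longleftrightarrow> 0 < L \<and> (\<forall>i. X i \<in> pverts T) \<and> (\<forall>i. \<phi> g (X i) = X (i + L)) \<and>
     (\<forall>i j. tdist (X i) (X j) = \<bar>i - j\<bar>)"

text \<open>
  Take \<open>x\<close> moved by the least distance \<open>L\<close>, and string together the translates of the geodesic from
  \<open>x\<close> to \<open>g x\<close>. Backtracking can only occur at a translate of \<open>x\<close>. If it does, then the
  vertex after \<open>x\<close> on the geodesic is moved by less than \<open>L\<close>, or else \<open>L = 1\<close> and \<open>g\<close> inverts an edge.
\<close>

lemma hyperbolic_has_axis:
  assumes g: "g \<in> carrier G" and nofix: "\<And>x. x \<in> pverts T \<Longrightarrow> \<phi> g x \<noteq> x"
  obtains L X where "axis g L X"
proof -
  obtain y where "y \<in> pverts T"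
    using tree by (auto simp: undirected_tree_def connected_def strongly_connected_def)
  then obtain x where x: "x \<in> pverts T"
    "\<forall>z. z \<in> pverts T \<longrightarrow> nat (tdist x (\<phi> g x)) \<le> nat (tdist z (\<phi> g z))"
    using ex_has_least_nat[of "\<lambda>x. x \<in> pverts T" y "\<lambda>x. nat (tdist x (\<phi> g x))"] by blast
  define L where "L = tdist x (\<phi> g x)"
  have gx: "\<phi> g x \<in> pverts T" using x g by simp
  have Lmin: "L \<le> tdist z (\<phi> g z)" if "z \<in> pverts T" for z
    using x(2) that tdist_nonneg[of z "\<phi> g z"] tdist_nonneg[of x "\<phi> g x"] x(1) g
    unfolding L_def by fastforce
  have L: "0 < L"
    using tdist_nonneg[OF x(1) gx] tdist_zeroD[OF x(1) gx] nofix[OF x(1)] unfolding L_def by force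
  have "\<forall>k\<in>{0..L}. \<exists>w. w \<in> pverts T \<and> tdist x w = k \<and> between x w (\<phi> g x)"
    using between_exists[OF x(1) gx] unfolding L_def by (metis atLeastAtMost_iff)
  then obtain P where P: "\<And>k. k \<in> {0..L} \<Longrightarrow> P k \<in> pverts T \<and> tdist x (P k) = k \<and> between x (P k) (\<phi> g x)"
    by (metis (no_types) bchoice)
  have tdP: "tdist (P i) (P j) = \<bar>i - j\<bar>" if "i \<in> {0..L}" "j \<in> {0..L}" for i j
    using P[OF that(1)] P[OF that(2)] tdist_between[OF x(1) gx, of "P i" "P j"] by simp
  have P0: "P 0 = x" using P[of 0] L tdist_zeroD[of x "P 0"] x(1) by auto
  have PL: "P L = \<phi> g x"
    using P[of L] L tdist_zeroD[of "P L" "\<phi> g x"] gx unfolding between_def L_def[symmetric] by auto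
  define X where "X i = \<phi> (g [^] (i div L)) (P (i mod L))" for i :: int
  have gq: "g [^] q \<in> carrier G" for q :: int using g by simp
  \<comment> \<open>The case \<open>k = L\<close> says that consecutive translates fit together.\<close>
  have Xq: "X (L * q + k) = \<phi> (g [^] q) (P k)" if "0 \<le> k" "k \<le> L" for q k
  proof (cases "k = L")
    case True
    have "X (L * q + k) = X (L * (q + 1) + 0)" using True by (simp add: algebra_simps)
    also have "\<dots> = \<phi> (g [^] (q + 1)) x" using L P0 unfolding X_def by simp
    also have "\<dots> = \<phi> (g [^] q \<otimes> g) x" using int_pow_mult[OF g, of q 1] g by simp
    also have "\<dots> = \<phi> (g [^] q) (P k)" using act_mult[OF gq g x(1)] True PL by simp
    finally show ?thesis .
  next
    case False
    then have "(L * q + k) div L = q" "(L * q + k) mod L = k" using that L by auto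
    then show ?thesis unfolding X_def by simp
  qed
  have V: "X i \<in> pverts T" for i
    unfolding X_def using P[of "i mod L"] L gq pos_mod_bound[OF L, of i] by (simp add: act_closed)
  have dec: "\<exists>q k. i = L * q + k \<and> 0 \<le> k \<and> k < L" for i
    by (intro exI[of _ "i div L"] exI[of _ "i mod L"]) (use L in auto)
  have shift: "\<phi> g (X i) = X (i + L)" for i
  proof -
    obtain q k where i: "i = L * q + k" "0 \<le> k" "k < L" using dec by blast
    have Pk: "P k \<in> pverts T" using P i by auto
    have iL: "i + L = L * (q + 1) + k" using i by (simp add: algebra_simps)
    have "X (i + L) = \<phi> (g [^] (q + 1)) (P k)" unfolding iL by (rule Xq) (use i in auto)
    also have "\<dots> = \<phi> (g \<otimes> g [^] q) (P k)"
      using int_pow_mult[OF g, of 1 q] g by (simp add: add.commute)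
    also have "\<dots> = \<phi> g (X i)" using act_mult[OF g gq Pk] Xq i by simp
    finally show ?thesis by simp
  qed
  have one: "tdist (X i) (X (i + 1)) = 1" for i
  proof -
    obtain q k where i: "i = L * q + k" "0 \<le> k" "k < L" using dec by blast
    have "tdist (X i) (X (i + 1)) = tdist (\<phi> (g [^] q) (P k)) (\<phi> (g [^] q) (P (k + 1)))"
      using Xq[of k q] Xq[of "k + 1" q] i by (simp add: add.assoc)
    also have "\<dots> = tdist (P k) (P (k + 1))" using act_tdist[OF gq] P i by simp
    finally show ?thesis using tdP i by simp
  qed
  have red: "X i \<noteq> X (i + 2)" for i
  proof
    assume eq: "X i = X (i + 2)"
    obtain q k where i: "i = L * q + k" "0 \<le> k" "k < L" using dec by blast
    have Pk: "P k \<in> pverts T" using P i by auto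
    show False
    proof (cases "k + 2 \<le> L")
      case True
      have Pk2: "P (k + 2) \<in> pverts T" using P True i by auto
      have "\<phi> (g [^] q) (P k) = \<phi> (g [^] q) (P (k + 2))"
        using eq Xq[of k q] Xq[of "k + 2" q] i True by (simp add: add.assoc)
      then have "P k = P (k + 2)" using act_eq_iff[OF gq Pk Pk2] by simp
      then show False using tdP[of k "k + 2"] Pk i True by simp
    next
      case False
      then have k: "k = L - 1" using i by simp
      have P1: "P 1 \<in> pverts T" using P L by auto
      have i2: "i + 2 = L * (q + 1) + 1" using i k by (simp add: algebra_simps)
      have "X (i + 2) = \<phi> (g [^] (q + 1)) (P 1)" unfolding i2 by (rule Xq) (use L in auto)
      also have "\<dots> = \<phi> (g [^] q \<otimes> g) (P 1)" using int_pow_mult[OF g, of q 1] g by simp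
      also have "\<dots> = \<phi> (g [^] q) (\<phi> g (P 1))" using act_mult[OF gq g P1] by simp
      finally have "\<phi> (g [^] q) (P k) = \<phi> (g [^] q) (\<phi> g (P 1))" using eq Xq[of k q] i by simp
      then have bt: "P k = \<phi> g (P 1)" using act_eq_iff[OF gq Pk] P1 g by simp
      show False
      proof (cases "L = 1")
        case True
        then have "x = \<phi> g (\<phi> g x)" using bt k P0 PL by simp
        moreover have "(x, \<phi> g x) \<in> parcs T" using tdist_oneD[OF x(1) gx] True L_def by simp
        ultimately show False using no_inversions[OF g] by metis
      next
        case False
        then have "tdist (P 1) (\<phi> g (P 1)) = L - 2" using bt[symmetric] k tdP[of 1 k] L by simp
        then show False using Lmin[OF P1] by simp
      qed
    qed
  qed
  have "axis g L X"
    unfolding axis_def using L V shift line_tdist[of X, OF V one red] by blast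
  then show ?thesis by (rule that)
qed

lemma axis_pow:
  assumes g: "g \<in> carrier G" and ax: "axis g L X"
  shows "\<phi> (g [^] (k::int)) (X i) = X (i + k * L)"
proof -
  have V: "X i \<in> pverts T" for i using ax by (simp add: axis_def)
  have nat: "\<phi> (g [^] (n::nat)) (X i) = X (i + int n * L)" for n i
  proof (induction n arbitrary: i)
    case (Suc n)
    have "\<phi> (g [^] Suc n) (X i) = \<phi> (g [^] n) (\<phi> g (X i))"
      using act_mult[of "g [^] n" g "X i"] g V by simp
    also have "\<dots> = X (i + int (Suc n) * L)"
      using ax Suc.IH by (simp add: axis_def algebra_simps)
    finally show ?case .
  qed (use V in simp)
  show ?thesis
  proof (cases "k \<ge> 0")
    case True
    then show ?thesis using nat[of "nat k" i] int_pow_int[of G g "nat k"] by simp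
  next
    case False
    define n where "n = nat (- k)"
    have k: "k = - int n" using False n_def by simp
    have "\<phi> (g [^] n) (X (i + k * L)) = X i" using nat[of n "i + k * L"] k by simp
    then have "X (i + k * L) = \<phi> (inv (g [^] n)) (X i)"
      using act_inv_left[of "g [^] n" "X (i + k * L)"] g V by simp
    then show ?thesis using int_pow_neg_int[OF g, of n] k by simp
  qed
qed

text \<open>
  A hyperbolic \<open>c\<close> of translation length \<open>L\<close> moves a vertex \<open>x\<close> of its axis under \<open>c\<^bsup>m k\<^esup>\<close> by \<open>\<bar>m\<bar> k L\<close>, and
  under the conjugate \<open>c\<^bsup>n k\<^esup>\<close> by \<open>\<bar>n\<bar> k L\<close>. Conjugation by \<open>t\<close> changes displacements by a
  bounded amount only, while \<open>k\<close> is arbitrary.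
\<close>

lemma hyperbolic_conj_powers:
  assumes c: "c \<in> carrier G" and t: "t \<in> carrier G" and hyp: "\<not> elliptic G T \<phi> c"
    and rel: "t \<otimes> c [^] (m::int) \<otimes> inv t = c [^] (n::int)"
  shows "\<bar>m\<bar> = \<bar>n\<bar>"
proof (rule ccontr)
  assume ne: "\<bar>m\<bar> \<noteq> \<bar>n\<bar>"
  have "\<phi> c x \<noteq> x" if "x \<in> pverts T" for x using hyp c that by (auto simp: elliptic_def)
  then obtain L X where ax: "axis c L X" using hyperbolic_has_axis[OF c] by blast
  define x where "x = X 0"
  define y where "y = \<phi> (inv t) x"
  have x: "x \<in> pverts T" and y: "y \<in> pverts T" using ax t by (auto simp: x_def y_def axis_def)
  have L: "0 < L" using ax by (simp add: axis_def)
  define C where "C = tdist x y"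
  define k where "k = 2 * C + 1"
  have C: "0 \<le> C" using tdist_nonneg x y by (simp add: C_def)
  have ck: "c [^] j \<in> carrier G" for j :: int using c by simp
  have len: "tdist x (\<phi> (c [^] (j * k)) x) = \<bar>j\<bar> * k * L" for j :: int
    using axis_pow[OF c ax, of "j * k" 0] ax C L
    by (simp add: x_def axis_def abs_mult k_def)
  have "c [^] (n * k) = t \<otimes> c [^] (m * k) \<otimes> inv t"
    using conj_int_pow[OF t ck, of m k] rel c by (simp add: int_pow_pow)
  then have "\<phi> (c [^] (n * k)) x = \<phi> t (\<phi> (c [^] (m * k)) y)"
    using t ck x by (simp add: act_mult y_def)
  then have "tdist x (\<phi> (c [^] (n * k)) x) = tdist (\<phi> t y) (\<phi> t (\<phi> (c [^] (m * k)) y))"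
    using t x by (simp add: y_def)
  also have "\<dots> = tdist y (\<phi> (c [^] (m * k)) y)" using t ck y by simp
  finally have n: "tdist y (\<phi> (c [^] (m * k)) y) = \<bar>n\<bar> * k * L" using len by simp
  have cm: "tdist (\<phi> (c [^] (m * k)) x) (\<phi> (c [^] (m * k)) y) = C" using ck x y by (simp add: C_def)
  have "\<bar>\<bar>n\<bar> * k * L - \<bar>m\<bar> * k * L\<bar> \<le> 2 * C"
    using tdist_triangle[of x "\<phi> (c [^] (m * k)) x" y] tdist_triangle[of y "\<phi> (c [^] (m * k)) x" "\<phi> (c [^] (m * k)) y"]
      tdist_triangle[of y "\<phi> (c [^] (m * k)) y" x] tdist_triangle[of x "\<phi> (c [^] (m * k)) y" "\<phi> (c [^] (m * k)) x"]
      n len[of m] cm tdist_sym[of x y] tdist_sym[of "\<phi> (c [^] (m * k)) x" "\<phi> (c [^] (m * k)) y"] x y ck C_def act_closed[OF ck]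
    by (smt (verit))
  moreover have "k \<le> \<bar>\<bar>n\<bar> * k * L - \<bar>m\<bar> * k * L\<bar>"
  proof -
    have "1 \<le> \<bar>\<bar>n\<bar> - \<bar>m\<bar>\<bar> * L" using ne L by (smt (verit) mult_pos_pos zero_less_abs_iff)
    then have "1 * k \<le> \<bar>\<bar>n\<bar> - \<bar>m\<bar>\<bar> * L * k" using C by (intro mult_right_mono) (auto simp: k_def)
    also have "\<dots> = \<bar>(\<bar>n\<bar> - \<bar>m\<bar>) * L * k\<bar>" using L C by (simp add: abs_mult k_def)
    also have "(\<bar>n\<bar> - \<bar>m\<bar>) * L * k = \<bar>n\<bar> * k * L - \<bar>m\<bar> * k * L" by (simp add: algebra_simps)
    finally show ?thesis by simp
  qed
  ultimately show False using C by (simp add: k_def)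
qed

text \<open>
  If \<open>t\<^sup>k\<close> conjugates a vertex stabilizer onto a subgroup containing it, then the modulus of \<open>t\<^sup>k\<close> is an
  integer; but no power of \<open>m / n\<close> with nonzero exponent is one.
\<close>

lemma stab_subset_shift:
  assumes t: "t \<in> carrier G" and v: "v \<in> pverts T"
    and r: "modular_hom G T \<phi> t = of_int m / of_int n"
    and mn: "coprime m n" "\<bar>m\<bar> \<ge> 2" "\<bar>n\<bar> \<ge> 2"
    and sub: "stab v \<subseteq> stab (\<phi> (t [^] (k::int)) v)"
  shows "k = 0"
proof -
  obtain b where b: "b \<in> carrier G" "stab v = range (\<lambda>k::int. b [^] k)"
    "\<And>k::int. b [^] k = \<one> \<longleftrightarrow> k = 0" using stab_generator[OF v] by blast
  have bv: "b \<in> stab v" using b(1,2) by (metis int_pow_1 rangeI)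
  have b1: "b \<noteq> \<one>" using b(3)[of 1] b(1) by auto
  define h where "h = t [^] k"
  have h: "h \<in> carrier G" using t by (simp add: h_def)
  have "inv h \<otimes> b \<otimes> h \<in> stab v"
    using stab_conj_inv[OF v h b(1)] sub bv by (auto simp: h_def)
  then obtain j :: int where j: "inv h \<otimes> b \<otimes> h = b [^] j" using b(2) by auto
  have "h \<otimes> b [^] j \<otimes> inv h = b [^] (1::int)"
    using h b(1) unfolding j[symmetric] by (simp add: m_assoc inv_cancel_left)
  moreover have "j \<noteq> 0"
  proof
    assume "j = 0"
    then have "b [^] (1::int) = \<one>" using calculation h by simp
    then show False using b(3)[of 1] by simp
  qed
  ultimately have "modular_hom G T \<phi> h = of_int j / of_int 1"
    using b1 bv v h by (intro modular_hom_eqI[of h b]) (auto simp: elliptic_iff)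
  then have "(of_int m / of_int n :: rat) powi k = of_int j"
    using modular_hom_pow[OF t, of k] r by (simp add: h_def)
  then show ?thesis using no_integral_power mn by blast
qed

text \<open>
  By \<open>stab_subset_shift\<close> there is no inclusion between the stabilizers of two different axis vertices
  in the same \<open>t\<close>-orbit, and there are only \<open>L\<close> orbits on the axis. Hence some stabilizer is maximal
  among those along the axis, and at most \<open>L\<close> vertices share it. They are consecutive, because
  whatever fixes two vertices fixes all vertices between them. The last one is \<open>X i\<close>, the first one
  \<open>X (i - s)\<close>.
\<close>

lemma axis_maximal_stab:
  assumes t: "t \<in> carrier G" and ax: "axis t L X"
    and r: "modular_hom G T \<phi> t = of_int m / of_int n"
    and mn: "coprime m n" "\<bar>m\<bar> \<ge> 2" "\<bar>n\<bar> \<ge> 2"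
  obtains i s where "0 \<le> s" "s < L" "stab (X (i - s)) = stab (X i)"
    "\<And>k. 0 < k \<Longrightarrow> \<not> stab (X i) \<subseteq> stab (X (i + k))" 
    "\<And>k. s < k \<Longrightarrow> \<not> stab (X i) \<subseteq> stab (X (i - k))"
    "\<And>k. 0 \<le> k \<Longrightarrow> k \<le> s \<Longrightarrow> stab (X i) \<subseteq> stab (X (i - k))"
proof -
  have V: "X i \<in> pverts T" for i using ax by (simp add: axis_def)
  have L: "0 < L" using ax by (simp add: axis_def)
  have key: "i = j" if sub: "stab (X i) \<subseteq> stab (X j)" and "i mod L = j mod L" for i j
  proof -
    have "L dvd j - i" using that(2) by (metis mod_eq_dvd_iff)
    then obtain q where q: "j = i + q * L" by (metis dvd_def add.commute diff_add_cancel mult.commute)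
    have "q = 0"
      using stab_subset_shift[OF t V r mn, of i q] axis_pow[OF t ax, of q i] sub q by simp
    then show ?thesis using q by simp
  qed
  \<comment> \<open>Passing to a larger stabilizer can only remove orbits from \<open>R\<close>; where \<open>R\<close> is smallest,
    the stabilizer is maximal.\<close>
  define R where "R i = {\<rho>\<in>{0..<L}. \<exists>j. j mod L = \<rho> \<and> stab (X i) \<subseteq> stab (X j)}" for i
  have fin: "finite (R i)" for i by (rule finite_subset[of _ "{0..<L}"]) (auto simp: R_def)
  obtain i0 where i0: "\<And>j. card (R i0) \<le> card (R j)"
    using ex_has_least_nat[of "\<lambda>_::int. True" 0 "\<lambda>i. card (R i)"] by blast
  have max: "stab (X j) = stab (X i0)" if sub: "stab (X i0) \<subseteq> stab (X j)" for j
  proof -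
    have "R j \<subseteq> R i0" using sub by (auto simp: R_def)
    then have "R j = R i0" using card_subset_eq[OF fin] i0[of j] card_mono[OF fin] by (metis le_antisym)
    moreover have "i0 mod L \<in> R i0" using L by (auto simp: R_def)
    ultimately have "i0 mod L \<in> R j" by simp
    then obtain j' where j': "j' mod L = i0 mod L" "stab (X j) \<subseteq> stab (X j')"
      unfolding R_def by blast
    then have "i0 = j'" using key[of i0 j'] sub by auto
    then show ?thesis using j' sub by auto
  qed
  define C where "C = {j. stab (X j) = stab (X i0)}"
  have "inj_on (\<lambda>j. j mod L) C" using key by (auto simp: C_def inj_on_def)
  moreover have "(\<lambda>j. j mod L) ` C \<subseteq> {0..<L}" using L by auto
  ultimately have finC: "finite C" by (metis finite_atLeastLessThan_int finite_imageD finite_subset)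
  have i0C: "i0 \<in> C" by (simp add: C_def)
  define i where "i = Max C"
  define s where "s = i - Min C"
  have iC: "i \<in> C" "i - s \<in> C"
    using Max_in[OF finC] Min_in[OF finC] i0C by (auto simp: i_def s_def)
  have s0: "0 \<le> s" using Min_le[OF finC iC(1)] by (simp add: s_def)
  have si: "stab (X i) = stab (X i0)" "stab (X (i - s)) = stab (X i0)" using iC by (auto simp: C_def)
  have mid: "stab (X i) \<subseteq> stab (X (i - k))" if "0 \<le> k" "k \<le> s" for k
  proof -
    have "between (X (i - s)) (X (i - k)) (X i)" using ax that by (simp add: axis_def between_def)
    then show ?thesis using stab_between[of "X (i - s)" "X i" "X (i - k)"] V si by auto
  qed
  show ?thesis
  proof
    show "s < L"
    proof (rule ccontr)
      assume "\<not> s < L"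
      then have "i = i - L" using key[of i "i - L"] mid[of L] L by simp
      then show False using L by simp
    qed
    show "\<not> stab (X i) \<subseteq> stab (X (i + k))" if "0 < k" for k
    proof
      assume "stab (X i) \<subseteq> stab (X (i + k))"
      then have "i + k \<in> C" using max si by (simp add: C_def)
      then show False using Max_ge[OF finC] that unfolding i_def by fastforce
    qed
    show "\<not> stab (X i) \<subseteq> stab (X (i - k))" if "s < k" for k
    proof
      assume "stab (X i) \<subseteq> stab (X (i - k))"
      then have "i - k \<in> C" using max si by (simp add: C_def)
      then show False using Min_le[OF finC] that unfolding s_def by fastforce
    qed
  qed (use s0 si mid in auto)
qed

end

section \<open>Reduced products\<close>

text \<open>
  Products \<open>a\<^bsup>k\<^esup> t\<^bsup>\<plusminus>1\<^esup> a\<^bsup>k'\<^esup> t\<^bsup>\<plusminus>1\<^esup> \<dots> t\<^bsup>\<plusminus>1\<^esup>\<close> without the pinches \<open>t a\<^bsup>m q\<^esup> t\<^sup>-\<^sup>1\<close> and \<open>t\<^sup>-\<^sup>1 a\<^bsup>n q\<^esup> t\<close>, as in Britton's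
  lemma. The last argument tells whether the last letter is \<open>t\<close> or its inverse.
\<close>

inductive reduced_product ::
  "('k, 'z) monoid_scheme \<Rightarrow> 'k \<Rightarrow> 'k \<Rightarrow> int \<Rightarrow> int \<Rightarrow> 'k \<Rightarrow> bool \<Rightarrow> bool"
  for K a t m n where
  reduced_base:
    "reduced_product K a t m n (a [^]\<^bsub>K\<^esub> (k::int) \<otimes>\<^bsub>K\<^esub> (if \<delta> then t else inv\<^bsub>K\<^esub> t)) \<delta>"
| reduced_step:
    "\<lbrakk>reduced_product K a t m n x \<epsilon>; \<epsilon> = \<delta> \<or> \<not> (if \<epsilon> then m else n) dvd k\<rbrakk> \<Longrightarrow>
     reduced_product K a t m n (x \<otimes>\<^bsub>K\<^esub> a [^]\<^bsub>K\<^esub> (k::int) \<otimes>\<^bsub>K\<^esub> (if \<delta> then t else inv\<^bsub>K\<^esub> t)) \<delta>"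

section \<open>A Baumslag--Solitar pair acting on the tree\<close>

context GBS_action
begin

text \<open>
  The geodesics from \<open>v\<close> to \<open>h v\<close> and to \<open>h\<^sup>-\<^sup>1 v\<close> have length \<open>2 B + L\<close>. In a reduced product in \<open>c\<close> and
  \<open>h\<close> the translates of these geodesics are strung together, and the three last conditions bound how
  much consecutive ones overlap: by \<open>L\<close> at a turn \<open>h c\<^bsup>k\<^esup> h\<^sup>-\<^sup>1\<close>, by \<open>B\<close> at a turn \<open>h\<^sup>-\<^sup>1 c\<^bsup>k\<^esup> h\<close>, and by \<open>B\<close>
  when the exponent of \<open>h\<close> keeps its sign. Each translate is thus longer than the overlaps at its two
  ends together.
\<close>

definition ping_pong_pair :: "'g \<Rightarrow> 'g \<Rightarrow> int \<Rightarrow> int \<Rightarrow> 'v \<Rightarrow> int \<Rightarrow> int \<Rightarrow> bool" where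
  "ping_pong_pair c h m n v B L \<longleftrightarrow>
     c \<in> stab v \<and> h \<in> carrier G \<and> v \<in> pverts T \<and> 0 < B \<and> B \<le> L \<and>
     tdist v (\<phi> h v) = 2 * B + L \<and>
     (\<forall>k::int. \<not> m dvd k \<longrightarrow> gp v (\<phi> (inv h) v) (\<phi> (c [^] k) (\<phi> (inv h) v)) < 2 * L) \<and>
     (\<forall>k::int. \<not> n dvd k \<longrightarrow> gp v (\<phi> h v) (\<phi> (c [^] k) (\<phi> h v)) < 2 * B) \<and>
     (\<forall>k::int. gp v (\<phi> (inv h) v) (\<phi> (c [^] k) (\<phi> h v)) < 2 * B)"

text \<open>
  The geodesic back from \<open>x v\<close> to \<open>v\<close> starts along the last of the translates for a length (\<open>L\<close> or
  \<open>B\<close>) which the overlap with the next translate does not reach. By the hyperbolic inequality, the next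
  translate therefore overlaps the whole geodesic no more than it overlaps the last translate, and
  enough of its own length remains.
\<close>

lemma ping_pong_invariant:
  assumes pp: "ping_pong_pair c h m n v B L"
    and red: "reduced_product G c h m n x \<epsilon>"
  shows "x \<in> carrier G \<and>
    2 * (if \<epsilon> then L else B) \<le> gp v (\<phi> (inv x) v) (\<phi> (if \<epsilon> then inv h else h) v)"
  using red
proof (induction rule: reduced_product.induct)
  have c: "c \<in> carrier G" and cv: "c \<in> stab v" and h: "h \<in> carrier G" and v: "v \<in> pverts T"
    and B: "0 < B" "B \<le> L" and tdh: "tdist v (\<phi> h v) = 2 * B + L"
    using pp by (auto simp: ping_pong_pair_def stab_iff)
  have ck: "c [^] k \<in> carrier G" "\<phi> (c [^] k) v = v" for k :: int
    using stab_pow[OF v cv, of k] by (auto simp: stab_iff)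
  have ick: "\<phi> (inv (c [^] k)) v = v" for k :: int using act_inv_left[OF ck(1) v, of k] ck(2) by simp
  have "tdist v (\<phi> (inv h) v) = tdist (\<phi> h v) (\<phi> h (\<phi> (inv h) v))"
    using h v by (simp del: act_inv_right)
  then have tdi: "tdist v (\<phi> (inv h) v) = 2 * B + L" using tdh h v tdist_sym by simp
  {
    case (reduced_base k \<delta>)
    have x: "inv (c [^] k \<otimes> (if \<delta> then h else inv h)) = (if \<delta> then inv h else h) \<otimes> inv (c [^] k)"
      using ck h by (simp add: inv_mult_group)
    have "\<phi> (inv (c [^] k \<otimes> (if \<delta> then h else inv h))) v = \<phi> (if \<delta> then inv h else h) v"
      unfolding x using act_mult[of "if \<delta> then inv h else h" "inv (c [^] k)" v] ck h v ick by simp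
    then show ?case using h v ck tdh tdi B by (cases \<delta>) (simp_all add: gp_def)
  next
    case (reduced_step x \<epsilon> \<delta> k)
    let ?q = "if \<delta> then h else inv h"
    let ?qi = "if \<delta> then inv h else h"
    define y where "y = \<phi> (if \<epsilon> then inv h else h) v"
    define g where "g = \<phi> (inv x) v"
    define z where "z = \<phi> (c [^] k) (\<phi> ?q v)"
    define \<beta> where "\<beta> = (if \<epsilon> \<and> \<not> \<delta> then L else B)"
    have x: "x \<in> carrier G" and IH: "2 * (if \<epsilon> then L else B) \<le> gp v g y"
      using reduced_step.IH by (auto simp: g_def y_def)
    have V: "y \<in> pverts T" "g \<in> pverts T" "z \<in> pverts T"
      using x h v ck by (auto simp: y_def g_def z_def)
    have q: "?q \<in> carrier G" "?qi \<in> carrier G" "inv ?q = ?qi" using h by auto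
    \<comment> \<open>The turn between the last letter of \<open>x\<close> and the new one.\<close>
    have over: "gp v y z < 2 * \<beta>"
    proof -
      have d: "c [^] (-k) = inv (c [^] k)" using c by (simp add: int_pow_neg)
      have "gp v (\<phi> h v) (\<phi> (c [^] k) (\<phi> (inv h) v)) =
          gp (\<phi> (c [^] (-k)) v) (\<phi> (c [^] (-k)) (\<phi> h v)) (\<phi> (c [^] (-k)) (\<phi> (c [^] k) (\<phi> (inv h) v)))"
        by (rule act_gp[symmetric]) (use ck h v in auto)
      also have "\<dots> = gp v (\<phi> (c [^] (-k)) (\<phi> h v)) (\<phi> (inv h) v)"
        using ck h v by (simp add: d ick)
      also have "\<dots> = gp v (\<phi> (inv h) v) (\<phi> (c [^] (-k)) (\<phi> h v))"
        by (rule gp_sym) (use ck h v in auto)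
      finally show ?thesis
        using pp reduced_step.hyps(2) unfolding y_def z_def \<beta>_def ping_pong_pair_def
        by (cases \<epsilon>; cases \<delta>) auto
    qed
    have "gp v g z < 2 * \<beta>"
      using gp_hyperbolic[of y g z v] gp_sym[of y g v] V v over IH B unfolding \<beta>_def
      by (auto split: if_splits simp: min_def)
    moreover have "gp v (\<phi> (inv (x \<otimes> c [^] k \<otimes> ?q)) v) (\<phi> ?qi v) = 2 * (2 * B + L) - gp v g z"
    proof -
      have "inv (x \<otimes> c [^] k \<otimes> ?q) = ?qi \<otimes> (inv (c [^] k) \<otimes> inv x)"
        using x ck q by (simp add: inv_mult_group m_assoc)
      then have e: "\<phi> (inv (x \<otimes> c [^] k \<otimes> ?q)) v = \<phi> ?qi (\<phi> (inv (c [^] k)) g)"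
        using act_mult[of ?qi "inv (c [^] k) \<otimes> inv x" v] act_mult[of "inv (c [^] k)" "inv x" v] q ck x v
        by (simp add: g_def)
      have cancel: "\<phi> (c [^] k) (\<phi> ?q (\<phi> ?qi w)) = \<phi> (c [^] k) w" if "w \<in> pverts T" for w
        using h that by simp
      have "gp v (\<phi> (inv (x \<otimes> c [^] k \<otimes> ?q)) v) (\<phi> ?qi v) =
          gp (\<phi> (c [^] k) (\<phi> ?q v)) (\<phi> (c [^] k) (\<phi> ?q (\<phi> ?qi (\<phi> (inv (c [^] k)) g))))
            (\<phi> (c [^] k) (\<phi> ?q (\<phi> ?qi v)))"
        unfolding e using q ck v V by (simp del: act_inv_left act_inv_right split del: if_split)
      also have "\<dots> = gp z g v"
        using cancel[of "\<phi> (inv (c [^] k)) g"] cancel[of v] ck V v by (simp add: z_def)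
      also have "\<dots> = 2 * tdist v z - gp v g z"
        using tdist_sym V v by (simp add: gp_def)
      also have "tdist v z = tdist (\<phi> (c [^] k) v) (\<phi> (c [^] k) (\<phi> ?q v))" using ck by (simp add: z_def)
      also have "\<dots> = tdist v (\<phi> ?q v)" by (rule act_tdist) (use ck v q in auto)
      also have "\<dots> = 2 * B + L" using tdh tdi by simp
      finally show ?thesis .
    qed
    ultimately show ?case
      using B x ck q by (cases \<epsilon>; cases \<delta>) (auto simp: \<beta>_def)
  }
qed

lemma ping_pong_nontrivial:
  assumes pp: "ping_pong_pair c h m n v B L"
    and red: "reduced_product G c h m n x \<epsilon>"
  shows "x \<otimes> c [^] (k::int) \<noteq> \<one>"
proof
  assume eq: "x \<otimes> c [^] k = \<one>"
  have v: "v \<in> pverts T" and c: "c \<in> stab v" and h: "h \<in> carrier G" and B: "0 < B" "B \<le> L"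
    using pp by (auto simp: ping_pong_pair_def)
  have xi: "x \<in> carrier G"
    "2 * (if \<epsilon> then L else B) \<le> gp v (\<phi> (inv x) v) (\<phi> (if \<epsilon> then inv h else h) v)"
    using ping_pong_invariant[OF pp red] by auto
  have ck: "c [^] k \<in> carrier G" "\<phi> (c [^] k) v = v"
    using stab_pow[OF v c, of k] by (auto simp: stab_iff)
  then have "inv x = c [^] k" using eq xi(1) by (metis inv_equality inv_inv inv_closed)
  then have "gp v (\<phi> (inv x) v) (\<phi> (if \<epsilon> then inv h else h) v) = 0"
    using ck h v by (simp add: gp_def)
  then show False using xi(2) B by (simp split: if_splits)
qed

text \<open>
  Choose a vertex \<open>v\<close> on the axis of \<open>t\<close> as in \<open>axis_maximal_stab\<close>, with stabilizer generated by \<open>b\<close>. The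
  elements of \<open>stab v\<close> fixing \<open>t v\<close> and those fixing \<open>t\<^sup>-\<^sup>1 v\<close> are generated by some \<open>b\<^sup>e\<close> and \<open>b\<^sup>f\<close> with
  \<open>t b\<^sup>f t\<^sup>-\<^sup>1 = b\<^sup>e\<close>. So \<open>f / e = m / n\<close>, and as \<open>m\<close> and \<open>n\<close> are coprime, there is \<open>c = b\<^bsup>k0\<^esup>\<close> with
  \<open>b\<^sup>e = c\<^sup>n\<close> and \<open>b\<^sup>f = c\<^sup>m\<close>. Now \<open>t c\<^sup>m t\<^sup>-\<^sup>1 = c\<^sup>n\<close>, a power \<open>c\<^sup>k\<close> fixes \<open>t v\<close> only if \<open>n\<close> divides \<open>k\<close>, and it
  fixes \<open>t\<^sup>-\<^sup>1 v\<close> only if \<open>m\<close> divides \<open>k\<close>.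

  Still \<open>c\<close> and \<open>t\<close> may satisfy further relations, because \<open>c\<^sup>k\<close> can fix much of the geodesics from \<open>v\<close>
  to \<open>t v\<close> and to \<open>t\<^sup>-\<^sup>1 v\<close>. Therefore \<open>t\<close> is replaced by \<open>h = t b t\<^sup>-\<^sup>1 b t\<close>. It satisfies the same relation,
  since \<open>b\<close> commutes with \<open>c\<close> and hence \<open>t b t\<^sup>-\<^sup>1\<close> with \<open>t c\<^sup>m t\<^sup>-\<^sup>1 = c\<^sup>n\<close>. The geodesic from \<open>v\<close> to \<open>h v\<close> goes
  forward along the axis to \<open>t v\<close> or somewhat less far, back along a translate, and forward again: three
  segments instead of one, while at a turn of a reduced product only parts of the outermost segments
  can overlap.
\<close>

lemma ping_pong_pair_exists:
  assumes t: "t \<in> carrier G" and r: "modular_hom G T \<phi> t = of_int m / of_int n"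
    and mn: "coprime m n" "\<bar>m\<bar> \<ge> 2" "\<bar>n\<bar> \<ge> 2"
  obtains c h v B L where "ping_pong_pair c h m n v B L" "c \<noteq> \<one>"
    "h \<otimes> c [^] m \<otimes> inv h = c [^] n"
proof -
  have nofix: "\<phi> t x \<noteq> x" if "x \<in> pverts T" for x
  proof
    assume "\<phi> t x = x"
    then have "modular_hom G T \<phi> t = 1"
      using t that by (intro modular_hom_elliptic) (auto simp: elliptic_def)
    then show False using no_integral_power[OF mn, of 1 1] r by simp
  qed
  obtain L X where ax: "axis t L X" using hyperbolic_has_axis[OF t nofix] by blast
  have V: "X i \<in> pverts T" and L: "0 < L" and shift: "\<phi> t (X i) = X (i + L)"
    and tdX: "tdist (X i) (X j) = \<bar>i - j\<bar>" for i j
    using ax by (auto simp: axis_def)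
  have shift': "\<phi> (inv t) (X i) = X (i - L)" for i
    using act_inv_left[OF t V, of "i - L"] shift by simp
  have btw: "between (X i) (X j) (X k)" if "i \<le> j \<and> j \<le> k \<or> k \<le> j \<and> j \<le> i" for i j k
    using that tdX by (auto simp: between_def)
  obtain i s where s: "0 \<le> s" "s < L" and su: "stab (X (i - s)) = stab (X i)"
    and fwd: "\<And>k. 0 < k \<Longrightarrow> \<not> stab (X i) \<subseteq> stab (X (i + k))" 
    and bwd: "\<And>k. s < k \<Longrightarrow> \<not> stab (X i) \<subseteq> stab (X (i - k))"
    and mid: "\<And>k. 0 \<le> k \<Longrightarrow> k \<le> s \<Longrightarrow> stab (X i) \<subseteq> stab (X (i - k))"
    by (rule axis_maximal_stab[OF t ax r mn]) (rule that)
  define v where "v = X i"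
  define B where "B = L - s"
  \<comment> \<open>\<open>w1\<close> is the first axis vertex with the same stabilizer as \<open>t v\<close>, which lies \<open>s\<close> further on;
    the path from \<open>v\<close> to \<open>h v\<close> turns back there.\<close>
  define w1 where "w1 = X (i + B)"
  have vV: "v \<in> pverts T" and w1V: "w1 \<in> pverts T" and B: "0 < B" "B \<le> L"
    using V s by (auto simp: v_def w1_def B_def)
  have tv: "\<phi> t v = X (i + L)" and itv: "\<phi> (inv t) v = X (i - L)"
    using shift shift' by (auto simp: v_def)
  obtain b where b: "b \<in> carrier G" "stab v = range (\<lambda>k::int. b [^] k)"
    "\<And>k::int. b [^] k = \<one> \<longleftrightarrow> k = 0" using stab_generator[OF vV] by blast
  have bv: "b \<in> stab v" using b(1,2) by (metis int_pow_1 rangeI)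
  have b1: "b \<noteq> \<one>" using b(3)[of 1] b(1) by auto
  have bell: "elliptic G T \<phi> b" using bv vV by (auto simp: elliptic_iff)
  have binj: "j = k" if "b [^] j = b [^] k" for j k :: int
    using int_pow_inj[OF b(1) _ that] b(3) by blast
  have bpow: "b [^] (j::int) \<in> stab v" "b [^] j \<in> carrier G" for j using b by auto
  have bX: "b \<in> stab (X j) \<longleftrightarrow> stab v \<subseteq> stab (X j)" for j
  proof
    assume "b \<in> stab (X j)"
    then show "stab v \<subseteq> stab (X j)" using stab_pow[OF V] b(2) by auto
  qed (use bv in auto)
  have stab_t: "stab (\<phi> t x) = {a \<in> carrier G. inv t \<otimes> a \<otimes> t \<in> stab x}" if "x \<in> pverts T" for x
    using stab_conj_inv[OF that t] stab_iff by blast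
  have w1tv: "stab w1 = stab (\<phi> t v)"
  proof -
    have "w1 = \<phi> t (X (i - s))" by (simp add: w1_def shift B_def algebra_simps)
    then show ?thesis using stab_t[OF V, of "i - s"] stab_t[OF vV] su by (simp add: v_def)
  qed

  define I where "I = {j::int. b [^] j \<in> stab (\<phi> t v)}"
  have tvV: "\<phi> t v \<in> pverts T" using t vV by simp
  have I_diff: "j - q * k \<in> I" if "j \<in> I" "k \<in> I" for j k q
  proof -
    have "b [^] (j - q * k) = b [^] j \<otimes> inv ((b [^] k) [^] q)"
      using b(1) by (simp add: int_pow_diff int_pow_pow mult.commute)
    then show ?thesis
      using that stab_mult[OF tvV] stab_inv[OF tvV] stab_pow[OF tvV] by (simp add: I_def)
  qed
  have "t \<otimes> b \<otimes> inv t \<noteq> \<one>"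
  proof
    assume "t \<otimes> b \<otimes> inv t = \<one>"
    then have "inv t \<otimes> (t \<otimes> b \<otimes> inv t) \<otimes> t = \<one>" using t by simp
    then show False using b1 b(1) t by (simp add: m_assoc inv_cancel_left)
  qed
  then obtain i1 j1 :: int where ij: "i1 \<noteq> 0" "j1 \<noteq> 0" "b [^] i1 = (t \<otimes> b \<otimes> inv t) [^] j1"
    using elliptic_commensurable[OF bell elliptic_conj[OF bell t] b1] by blast
  have "t \<otimes> b \<otimes> inv t \<in> stab (\<phi> t v)" using stab_conj[OF vV t b(1)] bv by simp
  then have i1: "i1 \<in> I" using stab_pow[OF tvV] ij by (simp add: I_def)
  have "0 \<in> I" using t vV by (simp add: I_def stab_iff)
  then have "\<bar>i1\<bar> \<in> I" using I_diff[OF _ i1, of 0 1] i1 by (simp add: abs_if)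
  then have "\<exists>k::nat. 0 < k \<and> int k \<in> I" using ij(1) by (intro exI[of _ "nat \<bar>i1\<bar>"]) simp
  then obtain e' :: nat where e': "0 < e'" "int e' \<in> I" "\<And>k::nat. 0 < k \<Longrightarrow> int k \<in> I \<Longrightarrow> e' \<le> k"
    using exists_least_iff[of "\<lambda>k::nat. 0 < k \<and> int k \<in> I"] by (metis not_le)
  define e where "e = int e'"
  have e: "0 < e" "e \<in> I" using e' by (auto simp: e_def)
  have I_dvd: "e dvd j" if "j \<in> I" for j
  proof (rule ccontr)
    assume "\<not> e dvd j"
    then have pos: "0 < j mod e" using e(1) by (metis dvd_eq_mod_eq_0 order_le_less pos_mod_sign)
    have "j mod e \<in> I"
      using I_diff[OF that e(2), of "j div e"] by (simp add: minus_div_mult_eq_mod)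
    then have "e' \<le> nat (j mod e)" using pos by (intro e'(3)) auto
    then show False using pos pos_mod_bound[OF e(1), of j] by (simp add: e_def)
  qed
  have "inv t \<otimes> b [^] e \<otimes> t \<in> stab v"
    using stab_conj_inv[OF vV t bpow(2)] e(2) by (simp add: I_def)
  then obtain f :: int where f: "inv t \<otimes> b [^] e \<otimes> t = b [^] f" using b(2) by auto
  have tf: "t \<otimes> b [^] f \<otimes> inv t = b [^] e"
    using t bpow unfolding f[symmetric] by (simp add: m_assoc inv_cancel_left)
  have "f \<noteq> 0"
  proof
    assume "f = 0"
    then have "b [^] e = \<one>" using tf t by simp
    then show False using b(3) e by simp
  qed
  then have "(of_int m / of_int n :: rat) = of_int f / of_int e"
    using modular_hom_eqI[OF t bell b1 _ _ tf] e r by simp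
  then have "rat_of_int (m * e) = of_int (f * n)"
    using mn e by (simp add: frac_eq_eq)
  then have me: "m * e = f * n" by (simp only: of_int_eq_iff)
  then have "n dvd e" using mn(1) by (metis coprime_commute coprime_dvd_mult_right_iff dvd_triv_right)
  then obtain k0 where k0: "e = n * k0" by (auto simp: dvd_def)
  have fm: "f = m * k0" using me mn(3) unfolding k0 by (auto simp: algebra_simps)
  have k00: "k0 \<noteq> 0" using k0 e by auto
  define c where "c = b [^] k0"
  have c: "c \<in> carrier G" "c \<in> stab v" "c \<noteq> \<one>" using b bpow k00 by (auto simp: c_def)
  have cpow: "c [^] j = b [^] (k0 * j)" for j :: int using b(1) by (simp add: c_def int_pow_pow)
  have trel: "t \<otimes> c [^] m \<otimes> inv t = c [^] n" using tf k0 fm by (simp add: cpow mult.commute)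
  have cpc: "c [^] j \<in> carrier G" "\<phi> (c [^] j) v = v" for j :: int
    using stab_pow[OF vV c(2), of j] by (auto simp: stab_iff)

  have c_fwd: "n dvd k" if "c [^] k \<in> stab (\<phi> t v)" for k
  proof -
    have "e dvd k0 * k" using that I_dvd by (simp add: cpow I_def)
    then show ?thesis using k0 k00 by (simp add: mult.commute)
  qed
  have c_bwd: "m dvd k" if "c [^] k \<in> stab (\<phi> (inv t) v)" for k
  proof -
    have "t \<otimes> c [^] k \<otimes> inv t \<in> stab (\<phi> t (\<phi> (inv t) v))"
      using stab_conj[of "\<phi> (inv t) v" t "c [^] k"] that t vV cpc by simp
    then have 1: "t \<otimes> c [^] k \<otimes> inv t \<in> stab v" using t vV by simp
    have 2: "t \<otimes> c [^] k \<otimes> inv t \<in> stab (\<phi> t v)"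
      using stab_conj[OF vV t cpc(1), of k] stab_pow[OF vV c(2), of k] by simp
    obtain j :: int where j: "t \<otimes> c [^] k \<otimes> inv t = b [^] j" using 1 b(2) by auto
    then have "j \<in> I" using 2 by (simp add: I_def)
    then obtain q where q: "j = e * q" using I_dvd by (auto simp: dvd_def)
    have "t \<otimes> c [^] k \<otimes> inv t = t \<otimes> b [^] (f * q) \<otimes> inv t"
      using conj_int_pow[OF t bpow(2), of f q] tf b(1) j q by (simp add: int_pow_pow)
    then have "c [^] k = b [^] (f * q)" using t cpc bpow by simp
    then have "k0 * k = f * q" using binj by (simp add: cpow)
    then show ?thesis using fm k00 by simp
  qed

  define w where "w = t \<otimes> b \<otimes> inv t"
  define h where "h = w \<otimes> b \<otimes> t"
  have w: "w \<in> carrier G" and h: "h \<in> carrier G" using t b(1) by (auto simp: w_def h_def)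
  have comm: "b \<otimes> c [^] j \<otimes> inv b = c [^] j" for j :: int
  proof -
    have "b \<otimes> c [^] j = c [^] j \<otimes> b"
      using int_pow_mult[OF b(1), of 1 "k0 * j"] int_pow_mult[OF b(1), of "k0 * j" 1] b(1)
      by (simp add: cpow add.commute)
    then show ?thesis using cpc b(1) by (simp add: m_assoc)
  qed
  have wcomm: "w \<otimes> c [^] n \<otimes> inv w = c [^] n"
  proof -
    have "w \<otimes> c [^] n \<otimes> inv w = t \<otimes> (b \<otimes> c [^] m \<otimes> inv b) \<otimes> inv t"
      using t b(1) cpc unfolding w_def trel[symmetric]
      by (simp add: m_assoc inv_mult_group inv_cancel_left)
    then show ?thesis using comm trel by simp
  qed
  have hrel: "h \<otimes> c [^] m \<otimes> inv h = c [^] n"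
  proof -
    have "h \<otimes> c [^] m \<otimes> inv h = w \<otimes> (b \<otimes> (t \<otimes> c [^] m \<otimes> inv t) \<otimes> inv b) \<otimes> inv w"
      using t b(1) w cpc by (simp add: h_def m_assoc inv_mult_group)
    then show ?thesis using trel comm wcomm by simp
  qed

  \<comment> \<open>The corners of the path from \<open>v\<close> to \<open>h v\<close> are \<open>w1\<close> and \<open>p2\<close>.\<close>
  define p2 where "p2 = \<phi> w v"
  define p3 where "p3 = \<phi> h v"
  have p: "p2 \<in> pverts T" "p3 \<in> pverts T" using w h vV by (auto simp: p2_def p3_def)
  have ww1: "\<phi> w w1 = w1"
  proof -
    have "b \<in> stab (X (i - s))" using su bv by (simp add: v_def)
    then have "w \<in> stab (\<phi> t (X (i - s)))" using stab_conj[OF V t b(1)] by (simp add: w_def)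
    moreover have "w1 = \<phi> t (X (i - s))" by (simp add: w1_def shift B_def algebra_simps)
    ultimately show ?thesis by (simp add: stab_iff)
  qed
  have bphi: "\<phi> b v = v" using bv by (simp add: stab_iff)
  have p3w: "p3 = \<phi> w (\<phi> b (\<phi> t v))"
    using t b(1) w vV tvV act_mult[of "w \<otimes> b" t v] act_mult[of w b "\<phi> t v"] by (simp add: p3_def h_def)
  have d1: "tdist v w1 = B" "tdist w1 v = B" using tdX B by (auto simp: v_def w1_def)
  have d2: "tdist w1 p2 = B" using act_tdist[OF w w1V vV] ww1 d1 by (simp add: p2_def)
  have dtv: "tdist v (\<phi> t v) = L" using tdX L by (simp add: v_def shift)
  have d3: "tdist p2 p3 = L"
    using act_tdist[OF w vV, of "\<phi> b (\<phi> t v)"] act_tdist[OF b(1) vV tvV] bphi dtv b(1) tvV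
    by (simp add: p2_def p3w)
  \<comment> \<open>\<open>w1\<close> is the first axis vertex fixed by \<open>w\<close>, so \<open>w\<close> moves the one before it; and \<open>v\<close> is the last
    one fixed by \<open>b\<close>. An even Gromov product less than two vanishes, so neither corner backtracks.\<close>
  have turn1: "gp w1 v p2 = 0"
  proof -
    define x' where "x' = X (i + B - 1)"
    have x': "x' \<in> pverts T" "between w1 x' v" "tdist w1 x' = 1"
      using V btw[of i "i + B - 1" "i + B"] btw[of "i + B" "i + B - 1" i] tdX B
      by (auto simp: x'_def w1_def v_def)
    have "x' \<noteq> \<phi> w x'"
    proof
      assume "x' = \<phi> w x'"
      moreover have "x' = \<phi> t (X (i - (s + 1)))" by (simp add: x'_def shift B_def algebra_simps)
      ultimately have "t \<otimes> b \<otimes> inv t \<in> stab (\<phi> t (X (i - (s + 1))))"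
        using w by (simp add: stab_iff w_def)
      then have "b \<in> stab (X (i - (s + 1)))" using stab_conj[OF V t b(1)] by simp
      then show False using bX bwd[of "s + 1"] by (simp add: v_def)
    qed
    then have "gp w1 v p2 < 2 * 1"
      using gp_less[of w1 v p2 x' "\<phi> w x'" 1] x' w1V vV p w ww1
        act_between[OF w w1V vV x'(1)] act_tdist[OF w w1V x'(1)]
      by (simp add: p2_def)
    then show ?thesis using gp_even[OF vV p(1) w1V] gp_nonneg[OF vV p(1) w1V] by presburger
  qed
  have next1: "between v (X (i + 1)) w1" "tdist v (X (i + 1)) = 1"
    using btw[of i "i + 1" "i + B"] tdX B by (auto simp: v_def w1_def)
  have bnext: "X (i + 1) \<noteq> \<phi> b (X (i + 1))"
    using bX[of "i + 1"] fwd[of 1] b(1) by (auto simp: stab_iff v_def)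
  have turn2: "gp p2 w1 p3 = 0"
  proof -
    let ?y = "\<phi> b (\<phi> t v)"
    have yV: "?y \<in> pverts T" using b(1) tvV by simp
    have "between v (X (i + 1)) (\<phi> t v)" using btw[of i "i + 1" "i + L"] L by (simp add: v_def shift)
    then have "between v (\<phi> b (X (i + 1))) ?y"
      using act_between[OF b(1) vV tvV, of "X (i + 1)"] V bphi by simp
    moreover have "tdist v (\<phi> b (X (i + 1))) = 1"
      using act_tdist[OF b(1) vV, of "X (i + 1)"] V bphi next1 by simp
    ultimately have "gp v w1 ?y < 2 * 1"
      using gp_less[of v w1 ?y "X (i + 1)" "\<phi> b (X (i + 1))" 1] next1 bnext vV w1V yV V b(1) by simp
    then have "gp v w1 ?y = 0" using gp_even[OF w1V yV vV] gp_nonneg[OF w1V yV vV] by presburger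
    moreover have "gp p2 w1 p3 = gp v w1 ?y"
      using act_gp[OF w w1V yV vV] ww1 by (simp add: p2_def p3w)
    ultimately show ?thesis by simp
  qed
  have d02: "tdist v p2 = 2 * B" using turn1 d1 d2 by (simp add: gp_def)
  have "gp p2 w1 v = 2 * B"
    using d02 d2 d1 tdist_sym[of p2 w1] tdist_sym[of p2 v] p w1V vV by (simp add: gp_def)
  then have "gp p2 v p3 \<le> 0"
    using gp_hyperbolic[OF w1V vV p(2) p(1)] turn2 B by (simp add: min_def split: if_splits)
  then have "gp p2 v p3 = 0" using gp_nonneg[OF vV p(2) p(1)] by simp
  then have d03: "tdist v p3 = 2 * B + L" and bt2: "between v p2 p3"
    using d02 d3 tdist_sym[of p2 v] p vV by (auto simp: gp_def between_def)
  have "between v w1 p2" using d1 d2 d02 by (simp add: between_def)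
  then have bt1: "between v w1 p3" using between_trans[OF vV w1V p(1) p(2)] bt2 by blast
  have btn: "between v (X (i + 1)) p3" using between_trans[OF vV V w1V p(2) next1(1) bt1] .

  define y where "y = \<phi> (inv h) v"
  have yV: "y \<in> pverts T" using h vV by (simp add: y_def)
  have itV: "\<phi> (inv t) v \<in> pverts T" using t vV by simp
  have btm: "between v (\<phi> (inv t) v) y"
  proof -
    have "\<phi> h (\<phi> (inv t) v) = p2"
      using act_mult[of "w \<otimes> b" t "\<phi> (inv t) v"] act_mult[of w b v] t b(1) w vV bphi
      by (simp add: h_def p2_def)
    moreover have "\<phi> h y = v" using h vV by (simp add: y_def)
    ultimately have "between (\<phi> h v) (\<phi> h (\<phi> (inv t) v)) (\<phi> h y)"
      using between_sym[OF vV p(1,2) bt2] by (simp add: p3_def)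
    then show ?thesis using act_between[OF h vV yV itV] by simp
  qed
  have dit: "tdist v (\<phi> (inv t) v) = L" using tdX L by (simp add: v_def shift')

  have over1: "gp v y (\<phi> (c [^] k) y) < 2 * L" if "\<not> m dvd k" for k
  proof -
    have "\<phi> (inv t) v \<noteq> \<phi> (c [^] k) (\<phi> (inv t) v)"
      using c_bwd[of k] that cpc by (auto simp: stab_iff)
    then show ?thesis
      using gp_less[of v y "\<phi> (c [^] k) y" "\<phi> (inv t) v" "\<phi> (c [^] k) (\<phi> (inv t) v)" L]
        act_between[OF cpc(1) vV yV itV, of k] act_tdist[OF cpc(1) vV itV, of k] vV yV itV cpc btm dit
      by simp
  qed
  have over2: "gp v p3 (\<phi> (c [^] k) p3) < 2 * B" if "\<not> n dvd k" for k
  proof -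
    have "c [^] k \<notin> stab w1" using c_fwd[of k] that w1tv by auto
    then have "w1 \<noteq> \<phi> (c [^] k) w1" using cpc by (auto simp: stab_iff)
    then show ?thesis
      using gp_less[of v p3 "\<phi> (c [^] k) p3" w1 "\<phi> (c [^] k) w1" B]
        act_between[OF cpc(1) vV p(2) w1V, of k] act_tdist[OF cpc(1) vV w1V, of k] vV p w1V cpc bt1 d1
      by simp
  qed
  have over3: "gp v y (\<phi> (c [^] k) p3) < 2 * B" for k :: int
  proof (cases "s = 0")
    case True
    \<comment> \<open>An overlap of length \<open>L\<close> would make \<open>t c\<^sup>k t\<close> elliptic, although its modulus is \<open>(m / n)\<^sup>2\<close>.\<close>
    then have BL: "B = L" "w1 = \<phi> t v" by (auto simp: B_def w1_def tv)
    have "\<phi> (inv t) v \<noteq> \<phi> (c [^] k) w1"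
    proof
      assume "\<phi> (inv t) v = \<phi> (c [^] k) w1"
      then have "\<phi> t (\<phi> (c [^] k) (\<phi> t v)) = v" using t vV BL by (metis act_inv_right)
      then have "\<phi> (t \<otimes> c [^] k \<otimes> t) v = v"
        using act_mult[of "t \<otimes> c [^] k" t v] act_mult[of t "c [^] k" "\<phi> t v"] t cpc vV by simp
      then have "elliptic G T \<phi> (t \<otimes> c [^] k \<otimes> t)"
        using t cpc vV by (auto simp: elliptic_def)
      then have "modular_hom G T \<phi> (t \<otimes> c [^] k \<otimes> t) = 1" by (rule modular_hom_elliptic)
      moreover have "modular_hom G T \<phi> (c [^] k) = 1"
        using cpc vV by (intro modular_hom_elliptic) (auto simp: elliptic_def)
      ultimately have "(of_int m / of_int n :: rat) powi 2 = of_int 1"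
        using modular_hom_mult[of "t \<otimes> c [^] k" t] modular_hom_mult[of t "c [^] k"] t cpc r mn(2)
        by (cases "m = 0") (simp_all add: power2_eq_square)
      then show False using no_integral_power[OF mn] by fastforce
    qed
    then show ?thesis
      using gp_less[of v y "\<phi> (c [^] k) p3" "\<phi> (inv t) v" "\<phi> (c [^] k) w1" L]
        act_between[OF cpc(1) vV p(2) w1V, of k] act_tdist[OF cpc(1) vV w1V, of k]
        vV yV p itV w1V cpc bt1 d1 btm dit BL by simp
  next
    case False
    \<comment> \<open>The geodesics part at once: \<open>b\<close> commutes with \<open>c\<^sup>k\<close> and fixes the vertex before \<open>v\<close>, but not the one
      after \<open>v\<close>.\<close>
    have prev: "between v (X (i - 1)) y" "tdist v (X (i - 1)) = 1"
      using between_trans[OF vV V itV yV, of "i - 1"] btw[of i "i - 1" "i - L"] L btm tdX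
      by (auto simp: v_def shift')
    have "X (i - 1) \<noteq> \<phi> (c [^] k) (X (i + 1))"
    proof
      assume eq: "X (i - 1) = \<phi> (c [^] k) (X (i + 1))"
      have "b \<in> stab (X (i - 1))" using mid[of 1] False s bv by (auto simp: v_def)
      then have "\<phi> b (\<phi> (c [^] k) (X (i + 1))) = \<phi> (c [^] k) (X (i + 1))"
        using eq by (simp add: stab_iff)
      moreover have "b \<otimes> c [^] k = c [^] k \<otimes> b"
        using comm[of k] cpc b(1) by (metis inv_solve_right m_closed)
      then have "\<phi> b (\<phi> (c [^] k) (X (i + 1))) = \<phi> (c [^] k) (\<phi> b (X (i + 1)))"
        using act_mult[OF b(1) cpc(1) V] act_mult[OF cpc(1) b(1) V] by metis
      ultimately show False
        using act_eq_iff[OF cpc(1), of "\<phi> b (X (i + 1))" "X (i + 1)" k] V b(1) bnext by simp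
    qed
    then have "gp v y (\<phi> (c [^] k) p3) < 2 * 1"
      using gp_less[of v y "\<phi> (c [^] k) p3" "X (i - 1)" "\<phi> (c [^] k) (X (i + 1))" 1]
        act_between[OF cpc(1) vV p(2) V, of k "i + 1"] act_tdist[OF cpc(1) vV V, of k "i + 1"]
        vV yV p V cpc btn next1 prev by simp
    then show ?thesis using B by simp
  qed
  have "ping_pong_pair c h m n v B L"
    unfolding ping_pong_pair_def
    using c h vV B d03 over1 over2 over3 by (simp add: p3_def y_def)
  then show ?thesis using that c(3) hrel by blast
qed

end

section \<open>Homomorphisms from presented groups\<close>

definition (in monoid) letter_val :: "('x \<Rightarrow> 'a) \<Rightarrow> 'x \<times> bool \<Rightarrow> 'a" where
  "letter_val f l = (if snd l then f (fst l) else inv (f (fst l)))"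

definition (in monoid) word_val :: "('x \<Rightarrow> 'a) \<Rightarrow> 'x word \<Rightarrow> 'a" where
  "word_val f u = foldr (\<lambda>l y. letter_val f l \<otimes> y) u \<one>"

context group
begin

lemma letter_val_closed: "range f \<subseteq> carrier G \<Longrightarrow> letter_val f l \<in> carrier G"
  by (auto simp: letter_val_def)

lemma word_val_Nil [simp]: "word_val f [] = \<one>"
  by (simp add: word_val_def)

lemma word_val_Cons [simp]: "word_val f (l # u) = letter_val f l \<otimes> word_val f u"
  by (simp add: word_val_def)

lemma word_val_closed: "range f \<subseteq> carrier G \<Longrightarrow> word_val f u \<in> carrier G"
  by (induction u) (auto simp: letter_val_closed)

lemma word_val_append:
  "range f \<subseteq> carrier G \<Longrightarrow> word_val f (u @ v) = word_val f u \<otimes> word_val f v"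
  by (induction u) (auto simp: letter_val_closed word_val_closed m_assoc)

lemma word_val_gen_pow:
  assumes "range f \<subseteq> carrier G"
  shows "word_val f (gen_pow x k) = f x [^] k"
proof -
  have fx: "f x \<in> carrier G" using assms by auto
  have rep: "word_val f (replicate n (x, b)) = letter_val f (x, b) [^] n" for n b
  proof (induction n)
    case (Suc n)
    then show ?case using nat_pow_Suc2[OF letter_val_closed[OF assms]] by simp
  qed simp
  show ?thesis
  proof (cases "0 \<le> k")
    case True
    then show ?thesis
      using int_pow_int[of G "f x" "nat k"] by (simp add: gen_pow_def rep letter_val_def)
  next
    case False
    then have "word_val f (gen_pow x k) = inv (f x) [^] nat (- k)"
      by (simp add: gen_pow_def rep letter_val_def)
    also have "\<dots> = inv (f x [^] nat (- k))" by (rule nat_pow_inv[OF fx])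
    also have "\<dots> = f x [^] k" using int_pow_neg_int[OF fx, of "nat (- k)"] False by simp
    finally show ?thesis .
  qed
qed

lemma word_val_pres_eq:
  assumes f: "range f \<subseteq> carrier G" and rel: "\<And>l r. (l, r) \<in> R \<Longrightarrow> word_val f l = word_val f r"
  shows "pres_eq R u v \<Longrightarrow> word_val f u = word_val f v"
proof (induction rule: pres_eq.induct)
  case (pres_cancel u x b v)
  have "f x \<in> carrier G" using f by auto
  then have "word_val f [(x, b), (x, \<not> b)] = \<one>"
    by (cases b) (simp_all add: letter_val_def)
  then show ?case using word_val_closed[OF f] by (simp only: word_val_append[OF f] l_one)
qed (simp_all add: word_val_append[OF f] rel)

text \<open>
  The universal property of a presentation. The value of a class may be read off from any
  representative, since the value of a word respects the relations.
\<close>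

lemma presented_group_lift:
  fixes R :: "('x word \<times> 'x word) set"
  assumes f: "range f \<subseteq> carrier G" and rel: "\<And>l r. (l, r) \<in> R \<Longrightarrow> word_val f l = word_val f r"
  obtains F where "F \<in> hom (presented_group R) G" "\<And>u. F (pres_class R u) = word_val f u"
proof -
  define F where "F X = word_val f (SOME u. u \<in> X)" for X
  have F: "F (pres_class R u) = word_val f u" for u
  proof -
    have "(SOME v. v \<in> pres_class R u) \<in> pres_class R u"
      by (rule someI[of _ u]) (simp add: pres_class_def pres_refl)
    then have "pres_eq R u (SOME v. v \<in> pres_class R u)" by (simp add: pres_class_def)
    then show ?thesis using word_val_pres_eq[OF f rel] by (simp add: F_def)
  qed
  have "F \<in> hom (presented_group R) G"
  proof (rule homI)
    fix X assume "X \<in> carrier (presented_group R)"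
    then show "F X \<in> carrier G" using F word_val_closed[OF f] by (auto simp: presented_group_def)
  next
    fix X Y assume "X \<in> carrier (presented_group R)" "Y \<in> carrier (presented_group R)"
    then obtain u v where "X = pres_class R u" "Y = pres_class R v"
      by (auto simp: presented_group_def)
    then show "F (X \<otimes>\<^bsub>presented_group R\<^esub> Y) = F X \<otimes> F Y"
      by (simp add: presented_group_mult F word_val_append[OF f])
  qed
  then show ?thesis using F that by blast
qed

end

lemma presented_group_word_val:
  "monoid.word_val (presented_group R) (\<lambda>x. pres_class R [(x, True)]) u = pres_class R u"
proof -
  interpret K: group "presented_group R" by (rule group_presented_group)
  have one: "\<one>\<^bsub>presented_group R\<^esub> = pres_class R []" by (simp add: presented_group_def)
  have inv: "inv\<^bsub>presented_group R\<^esub> pres_class R [(x, True)] = pres_class R [(x, False)]" for x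
  proof (rule K.inv_equality)
    have "pres_eq R ([] @ [(x, False), (x, \<not> False)] @ []) ([] @ [])" by (rule pres_cancel)
    then show "pres_class R [(x, False)] \<otimes>\<^bsub>presented_group R\<^esub> pres_class R [(x, True)] = \<one>\<^bsub>presented_group R\<^esub>"
      by (simp add: presented_group_mult one pres_class_eq_iff)
  qed (auto simp: presented_group_def)
  have letter: "K.letter_val (\<lambda>x. pres_class R [(x, True)]) l = pres_class R [l]" for l
    by (cases l; cases "snd l") (auto simp: K.letter_val_def inv)
  show ?thesis
  proof (induction u)
    case Nil
    then show ?case by (simp add: one)
  next
    case (Cons l u)
    then show ?case by (simp add: letter presented_group_mult)
  qed
qed

section \<open>Baumslag--Solitar groups\<close>

definition BS_rels :: "int \<Rightarrow> int \<Rightarrow> (bs_gen word \<times> bs_gen word) set" where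
  "BS_rels m n = {(gen_pow Gen_t 1 @ gen_pow Gen_a m @ gen_pow Gen_t (-1), gen_pow Gen_a n)}"

lemma BS_eq: "BS m n = presented_group (BS_rels m n)"
  by (simp add: BS_def BS_rels_def)

definition BS_a :: "int \<Rightarrow> int \<Rightarrow> bs_gen word set" where
  "BS_a m n = pres_class (BS_rels m n) [(Gen_a, True)]"

definition BS_t :: "int \<Rightarrow> int \<Rightarrow> bs_gen word set" where
  "BS_t m n = pres_class (BS_rels m n) [(Gen_t, True)]"

lemma group_BS: "group (BS m n)"
  by (simp add: BS_eq group_presented_group)

lemma BS_gens_closed: "BS_a m n \<in> carrier (BS m n)" "BS_t m n \<in> carrier (BS m n)"
  by (simp_all add: BS_eq BS_a_def BS_t_def presented_group_def)

lemma BS_relation: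
  "BS_t m n \<otimes>\<^bsub>BS m n\<^esub> BS_a m n [^]\<^bsub>BS m n\<^esub> m \<otimes>\<^bsub>BS m n\<^esub> inv\<^bsub>BS m n\<^esub> BS_t m n =
    BS_a m n [^]\<^bsub>BS m n\<^esub> n"
proof -
  interpret K: group "BS m n" by (rule group_BS)
  let ?R = "BS_rels m n"
  let ?f = "\<lambda>x. pres_class ?R [(x, True)]"
  have f: "range ?f \<subseteq> carrier (BS m n)" by (auto simp: BS_eq presented_group_def)
  have val: "K.word_val ?f u = pres_class ?R u" for u
    using presented_group_word_val[of ?R u] by (simp add: BS_eq)
  have "pres_eq ?R ([] @ (gen_pow Gen_t 1 @ gen_pow Gen_a m @ gen_pow Gen_t (-1)) @ [])
      ([] @ gen_pow Gen_a n @ [])"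
    by (rule pres_rel) (simp add: BS_rels_def)
  then have "K.word_val ?f (gen_pow Gen_t 1 @ gen_pow Gen_a m @ gen_pow Gen_t (-1)) =
      K.word_val ?f (gen_pow Gen_a n)"
    by (simp add: val pres_class_eq_iff)
  then have "?f Gen_t [^]\<^bsub>BS m n\<^esub> (1::int) \<otimes>\<^bsub>BS m n\<^esub> (?f Gen_a [^]\<^bsub>BS m n\<^esub> m \<otimes>\<^bsub>BS m n\<^esub>
      ?f Gen_t [^]\<^bsub>BS m n\<^esub> (-1::int)) = ?f Gen_a [^]\<^bsub>BS m n\<^esub> n"
    by (simp only: K.word_val_append[OF f] K.word_val_gen_pow[OF f])
  then show ?thesis
    using BS_gens_closed[of m n]
    by (simp add: K.int_pow_neg K.m_assoc BS_a_def[symmetric] BS_t_def[symmetric])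
qed

lemma (in group) BS_lift:
  assumes "a \<in> carrier G" "t \<in> carrier G" "t \<otimes> a [^] (m::int) \<otimes> inv t = a [^] (n::int)"
  obtains F where "F \<in> hom (BS m n) G" "F (BS_a m n) = a" "F (BS_t m n) = t"
proof -
  define f where "f x = (case x of Gen_a \<Rightarrow> a | Gen_t \<Rightarrow> t)" for x
  have f: "range f \<subseteq> carrier G" using assms by (auto simp: f_def split: bs_gen.split)
  have fx: "f Gen_a = a" "f Gen_t = t" by (simp_all add: f_def)
  have rel: "word_val f l = word_val f r" if "(l, r) \<in> BS_rels m n" for l r
    using that assms
    by (simp add: BS_rels_def word_val_append[OF f] word_val_gen_pow[OF f] fx int_pow_neg m_assoc)
  obtain F where "F \<in> hom (BS m n) G" "\<And>u. F (pres_class (BS_rels m n) u) = word_val f u"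
    using presented_group_lift[OF f rel] by (metis BS_eq)
  then show ?thesis
    using that[of F] assms by (simp add: BS_a_def BS_t_def letter_val_def fx)
qed

lemma BS_induct [consumes 1, case_names one step]:
  assumes "x \<in> carrier (BS m n)" and one: "P \<one>\<^bsub>BS m n\<^esub>"
    and step: "\<And>x y. x \<in> carrier (BS m n) \<Longrightarrow> P x \<Longrightarrow>
        y \<in> {BS_a m n, inv\<^bsub>BS m n\<^esub> BS_a m n, BS_t m n, inv\<^bsub>BS m n\<^esub> BS_t m n} \<Longrightarrow> P (x \<otimes>\<^bsub>BS m n\<^esub> y)"
  shows "P x"
proof -
  interpret K: group "BS m n" by (rule group_BS)
  let ?R = "BS_rels m n"
  let ?f = "\<lambda>x. pres_class ?R [(x, True)]"
  have f: "range ?f \<subseteq> carrier (BS m n)" by (auto simp: BS_eq presented_group_def)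
  have val: "K.word_val ?f u = pres_class ?R u" for u
    using presented_group_word_val[of ?R u] by (simp add: BS_eq)
  obtain u where "x = pres_class ?R u" using assms(1) by (auto simp: BS_eq presented_group_def)
  then have x: "x = K.word_val ?f u" by (simp add: val)
  have "P (K.word_val ?f u)"
  proof (induction u rule: rev_induct)
    case (snoc l u)
    obtain g b where l: "l = (g, b)" by fastforce
    have "K.letter_val ?f l \<in> {BS_a m n, inv\<^bsub>BS m n\<^esub> BS_a m n, BS_t m n, inv\<^bsub>BS m n\<^esub> BS_t m n}"
      by (cases g; cases b) (auto simp: l K.letter_val_def BS_a_def BS_t_def)
    then have "P (K.word_val ?f u \<otimes>\<^bsub>BS m n\<^esub> K.letter_val ?f l)"
      using step snoc K.word_val_closed[OF f] by blast
    then show ?case using K.letter_val_closed[OF f] by (simp add: K.word_val_append[OF f])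
  qed (use one in simp)
  then show ?thesis by (simp add: x)
qed

text \<open>
  The group acts on the rationals by \<open>a x = x + 1\<close> and \<open>t x = (n / m) x\<close>, and \<open>a\<close> moves \<open>0\<close>.
\<close>

lemma BS_a_nontrivial:
  assumes "m \<noteq> 0" "n \<noteq> 0"
  shows "BS_a m n \<noteq> \<one>\<^bsub>BS m n\<^esub>"
proof
  assume eq: "BS_a m n = \<one>\<^bsub>BS m n\<^esub>"
  define q :: rat where "q = of_int n / of_int m"
  have q: "q \<noteq> 0" using assms by (simp add: q_def)
  define aff :: "bs_gen \<times> bool \<Rightarrow> rat \<Rightarrow> rat" where
    "aff l x = (case l of (Gen_a, b) \<Rightarrow> if b then x + 1 else x - 1
       | (Gen_t, b) \<Rightarrow> if b then q * x else x / q)" for l x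
  define act where "act u x = foldr aff u x" for u x
  have act_append: "act (u @ v) x = act u (act v x)" for u v x by (simp add: act_def)
  have pow: "act (gen_pow Gen_a k) x = x + of_int k" for k x
  proof -
    have "act (replicate j (Gen_a, b)) x = (if b then x + of_nat j else x - of_nat j)" for j b
      by (induction j) (auto simp: act_def aff_def)
    then show ?thesis by (auto simp: gen_pow_def)
  qed
  have "pres_eq (BS_rels m n) u v \<Longrightarrow> act u = act v" for u v
  proof (induction rule: pres_eq.induct)
    case (pres_cancel u x b v)
    have "act [(x, b), (x, \<not> b)] y = y" for y
      using q by (cases x; cases b) (auto simp: act_def aff_def)
    then show ?case by (simp only: fun_eq_iff act_append) simp
  next
    case (pres_rel l r u v)
    have t: "act (gen_pow Gen_t 1) x = q * x" "act (gen_pow Gen_t (-1)) x = x / q" for x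
      by (simp_all add: gen_pow_def act_def aff_def)
    have "q * (x / q + of_int m) = x + of_int n" for x
      using q assms by (simp add: distrib_left) (simp add: q_def)
    then have "act l x = act r x" for x
      using pres_rel by (simp add: BS_rels_def act_append pow t)
    then show ?case by (simp add: fun_eq_iff act_append)
  qed auto
  moreover have "pres_eq (BS_rels m n) [(Gen_a, True)] []"
    using eq by (simp add: BS_a_def BS_eq presented_group_def pres_class_eq_iff)
  ultimately have "act [(Gen_a, True)] 0 = act [] 0" by metis
  then show False by (simp add: act_def aff_def)
qed

section \<open>Normal forms in groups generated by a Baumslag--Solitar pair\<close>

context group
begin

lemma relation_int_pow:
  assumes "a \<in> carrier G" "t \<in> carrier G" "t \<otimes> a [^] (m::int) \<otimes> inv t = a [^] (n::int)"
  shows "t \<otimes> a [^] (m * q) \<otimes> inv t = a [^] (n * q)" 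
    "inv t \<otimes> a [^] (n * q) \<otimes> t = a [^] (m * q)"
proof -
  show 1: "t \<otimes> a [^] (m * q) \<otimes> inv t = a [^] (n * q)"
    using conj_int_pow[of t "a [^] m" q] assms by (simp add: int_pow_pow)
  show "inv t \<otimes> a [^] (n * q) \<otimes> t = a [^] (m * q)"
    unfolding 1[symmetric] using assms(1,2) by (simp add: m_assoc inv_cancel_left)
qed

text \<open>
  Multiplying a reduced form by a generator gives a reduced form again, after removing a pinch if one
  has appeared. So every element of the group generated by \<open>a\<close> and \<open>t\<close> has a reduced form.
\<close>

definition reduced_form :: "'a \<Rightarrow> 'a \<Rightarrow> int \<Rightarrow> int \<Rightarrow> 'a \<Rightarrow> bool" where
  "reduced_form a t m n x \<longleftrightarrow> (\<exists>k::int. x = a [^] k) \<or>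
     (\<exists>y \<epsilon> (k::int). reduced_product G a t m n y \<epsilon> \<and> x = y \<otimes> a [^] k)"

lemma reduced_product_closed:
  assumes "a \<in> carrier G" "t \<in> carrier G"
  shows "reduced_product G a t m n x \<epsilon> \<Longrightarrow> x \<in> carrier G"
  by (induction rule: reduced_product.induct) (use assms in auto)

lemma reduced_form_mult_a:
  assumes "a \<in> carrier G" "t \<in> carrier G" "reduced_form a t m n x"
  shows "reduced_form a t m n (x \<otimes> a [^] (j::int))"
proof -
  consider k :: int where "x = a [^] k"
    | y \<epsilon> and k :: int where "reduced_product G a t m n y \<epsilon>" "x = y \<otimes> a [^] k"
    using assms(3) by (auto simp: reduced_form_def)
  then show ?thesis
  proof cases
    case 1
    then have "x \<otimes> a [^] j = a [^] (k + j)" using assms by (simp add: int_pow_mult)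
    then show ?thesis by (auto simp: reduced_form_def)
  next
    case 2
    then have "x \<otimes> a [^] j = y \<otimes> a [^] (k + j)"
      using assms reduced_product_closed[OF assms(1,2) 2(1)] by (simp add: int_pow_mult m_assoc)
    then show ?thesis using 2(1) by (auto simp: reduced_form_def)
  qed
qed

lemma reduced_form_mult_t:
  assumes a: "a \<in> carrier G" and t: "t \<in> carrier G"
    and rel: "t \<otimes> a [^] (m::int) \<otimes> inv t = a [^] (n::int)" and x: "reduced_form a t m n x"
  shows "reduced_form a t m n (x \<otimes> (if \<delta> then t else inv t))"
proof -
  let ?s = "\<lambda>\<delta>. if \<delta> then t else inv t"
  have s: "?s \<delta> \<in> carrier G" for \<delta> using t by simp
  have stepI: "reduced_form a t m n y" if "reduced_product G a t m n y \<epsilon>" for y \<epsilon>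
  proof -
    have "y = y \<otimes> a [^] (0::int)" using reduced_product_closed[OF a t that] by simp
    then show ?thesis using that unfolding reduced_form_def by blast
  qed
  consider k :: int where "x = a [^] k"
    | y \<epsilon> and k :: int where "reduced_product G a t m n y \<epsilon>" "x = y \<otimes> a [^] k"
      "\<epsilon> = \<delta> \<or> \<not> (if \<epsilon> then m else n) dvd k"
    | y \<epsilon> and k :: int where "reduced_product G a t m n y \<epsilon>" "x = y \<otimes> a [^] k"
      "\<epsilon> = (\<not> \<delta>)" "(if \<epsilon> then m else n) dvd k"
    using x unfolding reduced_form_def by (metis (full_types))
  then show ?thesis
  proof cases
    case 1
    then show ?thesis using stepI[OF reduced_base[of G a t m n k \<delta>]] by simp
  next
    case 2
    then show ?thesis using stepI[OF reduced_step[OF 2(1,3)]] by simp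
  next
    case 3
    have y: "y \<in> carrier G" using reduced_product_closed[OF a t 3(1)] .
    \<comment> \<open>The last two letters \<open>t\<close> cancel against each other.\<close>
    obtain j :: int where j: "?s \<epsilon> \<otimes> a [^] k \<otimes> ?s \<delta> = a [^] j"
    proof (cases \<epsilon>)
      case True
      then obtain q where "k = m * q" using 3 by (auto simp: dvd_def)
      then show ?thesis using that relation_int_pow(1)[OF a t rel] 3 True by auto
    next
      case False
      then obtain q where "k = n * q" using 3 by (auto simp: dvd_def)
      then show ?thesis using that relation_int_pow(2)[OF a t rel] 3 False by auto
    qed
    from 3(1) show ?thesis
    proof cases
      case (reduced_base i)
      have "x \<otimes> ?s \<delta> = a [^] i \<otimes> (?s \<epsilon> \<otimes> a [^] k \<otimes> ?s \<delta>)"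
        using a s reduced_base 3(2) by (simp add: m_assoc)
      then have "x \<otimes> ?s \<delta> = a [^] (i + j)" using j a by (simp add: int_pow_mult)
      then show ?thesis unfolding reduced_form_def by blast
    next
      case (reduced_step z \<epsilon>' i)
      have z: "z \<in> carrier G" using reduced_product_closed[OF a t reduced_step(2)] .
      have "x \<otimes> ?s \<delta> = z \<otimes> a [^] i \<otimes> (?s \<epsilon> \<otimes> a [^] k \<otimes> ?s \<delta>)"
        using a s z reduced_step 3(2) by (simp add: m_assoc)
      then have "x \<otimes> ?s \<delta> = z \<otimes> a [^] (i + j)" using j a z by (simp add: int_pow_mult m_assoc)
      then show ?thesis using reduced_step(2) unfolding reduced_form_def by blast
    qed
  qed
qed

text \<open>
  If \<open>n = \<plusminus>1\<close>, then \<open>t\<^sup>-\<^sup>1 a t\<close> is a power of \<open>a\<close>. Hence negative powers of \<open>t\<close> can be moved to the right past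
  powers of \<open>a\<close>, and products \<open>t\<^sup>i a\<^sup>k t\<^sup>-\<^sup>j\<close> exhaust the group generated by \<open>a\<close> and \<open>t\<close>.
\<close>

lemma ascending_form_mult:
  assumes a: "a \<in> carrier G" and t: "t \<in> carrier G"
    and rel: "t \<otimes> a [^] (m::int) \<otimes> inv t = a [^] (n::int)" and n: "\<bar>n\<bar> = 1"
    and x: "\<exists>(i::nat) (k::int) (j::nat). x = t [^] i \<otimes> a [^] k \<otimes> inv t [^] j"
    and y: "y \<in> {a, inv a, t, inv t}"
  shows "\<exists>(i::nat) (k::int) (j::nat). x \<otimes> y = t [^] i \<otimes> a [^] k \<otimes> inv t [^] j"
proof -
  obtain i k j where x: "x = t [^] (i::nat) \<otimes> a [^] (k::int) \<otimes> inv t [^] (j::nat)" using x by blast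
  have nn: "n * n = 1" using n by (metis abs_mult_self_eq mult_1)
  have shift: "inv t \<otimes> a [^] l = a [^] (m * (n * l)) \<otimes> inv t" for l :: int
  proof -
    have "a [^] (m * (n * l)) = inv t \<otimes> a [^] (n * (n * l)) \<otimes> t"
      using relation_int_pow(2)[OF a t rel, of "n * l"] by simp
    then have "a [^] (m * (n * l)) = inv t \<otimes> a [^] l \<otimes> t" using nn by (simp flip: mult.assoc)
    then show ?thesis using a t by (simp add: m_assoc)
  qed
  have shifts: "\<exists>l'::int. inv t [^] j \<otimes> a [^] l = a [^] l' \<otimes> inv t [^] j" for l :: int and j :: nat
  proof (induction j)
    case 0
    then show ?case using a t by auto
  next
    case (Suc j)
    then obtain l' :: int where l': "inv t [^] j \<otimes> a [^] l = a [^] l' \<otimes> inv t [^] j" by blast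
    have "inv t [^] Suc j \<otimes> a [^] l = inv t \<otimes> (inv t [^] j \<otimes> a [^] l)"
      using a t nat_pow_Suc2[of "inv t" j] by (simp add: m_assoc)
    also have "\<dots> = (inv t \<otimes> a [^] l') \<otimes> inv t [^] j" unfolding l' using a t by (simp add: m_assoc)
    also have "\<dots> = a [^] (m * (n * l')) \<otimes> inv t [^] Suc j"
      unfolding shift using a t nat_pow_Suc2[of "inv t" j] by (simp add: m_assoc)
    finally show ?case by blast
  qed
  have mult_a: ?thesis if "y = a [^] (l::int)" for l
  proof -
    obtain l' :: int where l': "inv t [^] j \<otimes> a [^] l = a [^] l' \<otimes> inv t [^] j" using shifts by blast
    have "x \<otimes> y = t [^] i \<otimes> a [^] k \<otimes> (inv t [^] j \<otimes> a [^] l)"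
      unfolding x that using a t by (simp add: m_assoc)
    also have "\<dots> = t [^] i \<otimes> a [^] (k + l') \<otimes> inv t [^] j"
      unfolding l' using a t by (simp add: m_assoc int_pow_mult)
    finally show ?thesis by blast
  qed
  consider "y = a" | "y = inv a" | "y = t" "j = 0" | j' where "y = t" "j = Suc j'" | "y = inv t"
    using y by (cases j) auto
  then show ?thesis
  proof cases
    case 1
    then show ?thesis using mult_a[of 1] a by simp
  next
    case 2
    then show ?thesis using mult_a[of "-1"] a by (simp add: int_pow_neg)
  next
    case 3
    have "inv t \<otimes> a [^] k \<otimes> t = a [^] (m * (n * k))"
      unfolding shift using a t by (simp add: m_assoc)
    then have "t \<otimes> a [^] (m * (n * k)) = a [^] k \<otimes> t"
      using a t by (metis inv_cancel_left(2) int_pow_closed inv_closed m_assoc m_closed)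
    then have "x \<otimes> y = t [^] Suc i \<otimes> a [^] (m * (n * k)) \<otimes> inv t [^] (0::nat)"
      using 3 x a t by (simp add: m_assoc)
    then show ?thesis by blast
  next
    case 4
    then have "x \<otimes> y = t [^] i \<otimes> a [^] k \<otimes> inv t [^] j'"
      using x a t by (simp add: m_assoc)
    then show ?thesis by blast
  next
    case 5
    then have "x \<otimes> y = t [^] i \<otimes> a [^] k \<otimes> inv t [^] Suc j"
      using x a t by (simp add: m_assoc)
    then show ?thesis by blast
  qed
qed

end

section \<open>Embedding Baumslag--Solitar groups\<close>

lemma BS_reduced_form:
  assumes "x \<in> carrier (BS m n)"
  shows "group.reduced_form (BS m n) (BS_a m n) (BS_t m n) m n x"
proof -
  interpret K: group "BS m n" by (rule group_BS)
  show ?thesis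
    using assms
  proof (induction rule: BS_induct)
    case one
    have "\<one>\<^bsub>BS m n\<^esub> = BS_a m n [^]\<^bsub>BS m n\<^esub> (0::int)" by simp
    then show ?case unfolding K.reduced_form_def by blast
  next
    case (step x y)
    have x: "K.reduced_form (BS_a m n) (BS_t m n) m n x" by (rule step.IH)
    have "K.reduced_form (BS_a m n) (BS_t m n) m n (x \<otimes>\<^bsub>BS m n\<^esub> BS_a m n [^]\<^bsub>BS m n\<^esub> j)" for j :: int
      using K.reduced_form_mult_a[OF BS_gens_closed x] .
    from this[of 1] this[of "-1"] show ?case
      using K.reduced_form_mult_t[OF BS_gens_closed BS_relation x, of True]
        K.reduced_form_mult_t[OF BS_gens_closed BS_relation x, of False]
        step.hyps(2) BS_gens_closed[of m n]
      by (elim insertE) (simp_all add: K.int_pow_neg)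
  qed
qed

lemma reduced_product_hom:
  assumes "group_hom K G F" "a \<in> carrier K" "t \<in> carrier K"
  shows "reduced_product K a t m n x \<epsilon> \<Longrightarrow> reduced_product G (F a) (F t) m n (F x) \<epsilon>"
proof -
  interpret F: group_hom K G F by fact
  have s: "F (if \<delta> then t else inv\<^bsub>K\<^esub> t) = (if \<delta> then F t else inv\<^bsub>G\<^esub> F t)" for \<delta>
    using assms by simp
  show "reduced_product K a t m n x \<epsilon> \<Longrightarrow> reduced_product G (F a) (F t) m n (F x) \<epsilon>"
  proof (induction rule: reduced_product.induct)
    case (reduced_base k \<delta>)
    show ?case
      using reduced_product.reduced_base[of G "F a" "F t" m n k \<delta>] assms
      by (simp add: F.hom_int_pow split: if_splits)
  next
    case (reduced_step x \<epsilon> \<delta> k)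
    have "x \<in> carrier K" using F.G.reduced_product_closed reduced_step assms by blast
    then show ?case
      using reduced_product.reduced_step[OF reduced_step.IH reduced_step.hyps(2)] assms
      by (simp add: F.hom_int_pow split: if_splits)
  qed
qed

lemma (in GBS_action) BS_hom_injective_ping_pong:
  assumes F: "F \<in> hom (BS m n) G" and pp: "ping_pong_pair (F (BS_a m n)) (F (BS_t m n)) m n v B L"
    and nontriv: "F (BS_a m n) \<noteq> \<one>"
    and x: "x \<in> carrier (BS m n)" "F x = \<one>"
  shows "x = \<one>\<^bsub>BS m n\<^esub>"
proof -
  interpret K: group "BS m n" by (rule group_BS)
  interpret F: group_hom "BS m n" G F by unfold_locales (rule F)
  let ?a = "BS_a m n" and ?t = "BS_t m n"
  have ell: "elliptic G T \<phi> (F ?a)" using pp by (auto simp: ping_pong_pair_def elliptic_iff)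
  consider k :: int where "x = ?a [^]\<^bsub>BS m n\<^esub> k"
    | y \<epsilon> and k :: int where "reduced_product (BS m n) ?a ?t m n y \<epsilon>" "x = y \<otimes>\<^bsub>BS m n\<^esub> ?a [^]\<^bsub>BS m n\<^esub> k"
    using BS_reduced_form[OF x(1)] unfolding K.reduced_form_def by blast
  then show ?thesis
  proof cases
    case 1
    then have "F ?a [^] k = \<one>" using x(2) F.hom_int_pow BS_gens_closed by simp
    then have "k = 0" using elliptic_torsion_free ell nontriv by blast
    then show ?thesis using 1 by simp
  next
    case 2
    have "y \<in> carrier (BS m n)" using K.reduced_product_closed[OF BS_gens_closed] 2(1) .
    then have "F y \<otimes> F ?a [^] k = \<one>"
      using 2(2) x(2) F.hom_int_pow BS_gens_closed[of m n] by simp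
    moreover have "reduced_product G (F ?a) (F ?t) m n (F y) \<epsilon>"
      using reduced_product_hom[OF F.group_hom_axioms BS_gens_closed] 2(1) .
    ultimately show ?thesis using ping_pong_nontrivial[OF pp] by blast
  qed
qed

text \<open>
  The modulus of \<open>F x\<close> is that of \<open>F t\<close> to the power \<open>i - j\<close>. So \<open>F x = 1\<close> forces \<open>i = j\<close>, whence a conjugate of
  \<open>F a\<^sup>k\<close> is trivial, but \<open>F a\<close> has infinite order.
\<close>

lemma (in GBS_action) ascending_kernel_trivial:
  assumes F: "group_hom K G F" and a: "a \<in> carrier K" and t: "t \<in> carrier K"
    and ell: "elliptic G T \<phi> (F a)" "F a \<noteq> \<one>"
    and r: "\<bar>modular_hom G T \<phi> (F t)\<bar> \<noteq> 1"
    and x: "x = t [^]\<^bsub>K\<^esub> (i::nat) \<otimes>\<^bsub>K\<^esub> a [^]\<^bsub>K\<^esub> (k::int) \<otimes>\<^bsub>K\<^esub> inv\<^bsub>K\<^esub> t [^]\<^bsub>K\<^esub> (j::nat)" "F x = \<one>"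
  shows "x = \<one>\<^bsub>K\<^esub>"
proof -
  interpret F: group_hom K G F by fact
  let ?D = "modular_hom G T \<phi>"
  have Ft: "F t \<in> carrier G" and Fa: "F a \<in> carrier G" using a t by auto
  have Fx: "F t [^] i \<otimes> F a [^] k \<otimes> inv (F t) [^] j = \<one>"
    using x a t by (simp add: F.hom_int_pow F.hom_nat_pow)
  have Dpow: "?D (g [^] (l::nat)) = ?D g ^ l" if "g \<in> carrier G" for g l
    using modular_hom_pow[OF that, of "int l"] by (simp add: int_pow_int)
  obtain y where y: "y \<in> pverts T" "F a \<in> stab y" using ell by (auto simp: elliptic_iff)
  have "?D (F a [^] k) = 1"
    using stab_pow[OF y, of k] y(1) by (intro modular_hom_elliptic) (auto simp: elliptic_iff)
  then have "?D (F t) ^ i * inverse (?D (F t)) ^ j = 1"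
    using modular_hom_mult[of "F t [^] i \<otimes> F a [^] k" "inv (F t) [^] j"]
      modular_hom_mult[of "F t [^] i" "F a [^] k"] Fx Ft Fa modular_hom_one
    by (simp add: Dpow modular_hom_inv)
  then have "?D (F t) ^ i = ?D (F t) ^ j"
    using modular_hom_nonzero[OF Ft] by (simp add: field_simps)
  then have "\<bar>?D (F t)\<bar> ^ i = \<bar>?D (F t)\<bar> ^ j" by (simp flip: power_abs)
  then have ij: "i = j"
    using r modular_hom_nonzero[OF Ft] by (metis linorder_neqE_nat linorder_neqE power_strict_decreasing
        power_strict_increasing order_less_irrefl zero_less_abs_iff)
  have "F a [^] k = inv (F t [^] i) \<otimes> (F t [^] i \<otimes> F a [^] k \<otimes> inv (F t) [^] j) \<otimes> F t [^] i"
    using Ft Fa ij by (simp add: m_assoc inv_cancel_left nat_pow_inv)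
  then have "F a [^] k = \<one>" using Fx Ft by simp
  then have "k = 0" using elliptic_torsion_free ell by blast
  then show ?thesis using x(1) ij t by (simp add: F.nat_pow_inv)
qed

text \<open>
  If \<open>m = \<plusminus>1\<close> instead of \<open>n = \<plusminus>1\<close>, then \<open>t\<^sup>-\<^sup>1\<close> takes the place of \<open>t\<close>.
\<close>

lemma (in GBS_action) BS_hom_injective_ascending:
  assumes F: "F \<in> hom (BS m n) G" and mn: "\<bar>m\<bar> = 1 \<or> \<bar>n\<bar> = 1"
    and ell: "elliptic G T \<phi> (F (BS_a m n))" "F (BS_a m n) \<noteq> \<one>"
    and r: "\<bar>modular_hom G T \<phi> (F (BS_t m n))\<bar> \<noteq> 1"
    and x: "x \<in> carrier (BS m n)" "F x = \<one>"
  shows "x = \<one>\<^bsub>BS m n\<^esub>"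
proof -
  interpret K: group "BS m n" by (rule group_BS)
  interpret F: group_hom "BS m n" G F by unfold_locales (rule F)
  let ?a = "BS_a m n" and ?t = "BS_t m n"
  have *: ?thesis
    if s: "s \<in> {?t, inv\<^bsub>BS m n\<^esub> ?t}"
      "s \<otimes>\<^bsub>BS m n\<^esub> ?a [^]\<^bsub>BS m n\<^esub> m' \<otimes>\<^bsub>BS m n\<^esub> inv\<^bsub>BS m n\<^esub> s = ?a [^]\<^bsub>BS m n\<^esub> n'" "\<bar>n'\<bar> = 1"
    for s and m' n' :: int
  proof -
    have sc: "s \<in> carrier (BS m n)" using s BS_gens_closed[of m n] by auto
    have "\<exists>(i::nat) (k::int) (j::nat). x = s [^]\<^bsub>BS m n\<^esub> i \<otimes>\<^bsub>BS m n\<^esub> ?a [^]\<^bsub>BS m n\<^esub> k \<otimes>\<^bsub>BS m n\<^esub>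
        inv\<^bsub>BS m n\<^esub> s [^]\<^bsub>BS m n\<^esub> j"
      using x(1)
    proof (induction rule: BS_induct)
      case one
      have "\<one>\<^bsub>BS m n\<^esub> = s [^]\<^bsub>BS m n\<^esub> (0::nat) \<otimes>\<^bsub>BS m n\<^esub> ?a [^]\<^bsub>BS m n\<^esub> (0::int) \<otimes>\<^bsub>BS m n\<^esub>
        inv\<^bsub>BS m n\<^esub> s [^]\<^bsub>BS m n\<^esub> (0::nat)" by simp
      then show ?case by blast
    next
      case (step x y)
      have "y \<in> {?a, inv\<^bsub>BS m n\<^esub> ?a, s, inv\<^bsub>BS m n\<^esub> s}"
        using step.hyps(2) s(1) K.inv_inv[OF BS_gens_closed(2)] by (metis insert_iff singletonD)
      then show ?case by (rule K.ascending_form_mult[OF BS_gens_closed(1) sc s(2,3) step.IH])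
    qed
    moreover have "\<bar>modular_hom G T \<phi> (F s)\<bar> \<noteq> 1"
      using r s(1) BS_gens_closed[of m n] by (auto simp: modular_hom_inv)
    ultimately show ?thesis
      using ascending_kernel_trivial[OF F.group_hom_axioms BS_gens_closed(1) sc ell] x(2) by blast
  qed
  show ?thesis
  proof (cases "\<bar>n\<bar> = 1")
    case True
    then show ?thesis using *[OF _ BS_relation] by simp
  next
    case False
    have "inv\<^bsub>BS m n\<^esub> ?t \<otimes>\<^bsub>BS m n\<^esub> ?a [^]\<^bsub>BS m n\<^esub> n \<otimes>\<^bsub>BS m n\<^esub> inv\<^bsub>BS m n\<^esub> (inv\<^bsub>BS m n\<^esub> ?t) = ?a [^]\<^bsub>BS m n\<^esub> m"
      using K.relation_int_pow(2)[OF BS_gens_closed BS_relation, of 1] BS_gens_closed[of m n] by simp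
    then show ?thesis using *[of "inv\<^bsub>BS m n\<^esub> ?t" n m] mn False by simp
  qed
qed

text \<open>
  When \<open>m\<close> or \<open>n\<close> is \<open>\<plusminus>1\<close>, any elliptic solution \<open>c \<noteq> 1\<close> of \<open>g c\<^sup>m g\<^sup>-\<^sup>1 = c\<^sup>n\<close> embeds \<open>BS m n\<close> together with \<open>g\<close>.
  Otherwise \<open>c\<close> has to be chosen with care, and \<open>g\<close> has to be changed.
\<close>

lemma (in GBS_action) BS_embeds:
  assumes g: "g \<in> carrier G" and r: "modular_hom G T \<phi> g = of_int m / of_int n"
    and mn: "m \<noteq> 0" "n \<noteq> 0" "coprime m n" and ne: "\<bar>m\<bar> \<noteq> \<bar>n\<bar>"
  obtains F where "F \<in> hom (BS m n) G" "\<And>x. x \<in> carrier (BS m n) \<Longrightarrow> F x = \<one> \<Longrightarrow> x = \<one>\<^bsub>BS m n\<^esub>"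
proof (cases "\<bar>m\<bar> = 1 \<or> \<bar>n\<bar> = 1")
  case True
  obtain a where a: "elliptic G T \<phi> a" "a \<noteq> \<one>" using nontrivial_elliptic_exists by blast
  obtain k l :: int where kl: "k \<noteq> 0" "l \<noteq> 0" "g \<otimes> (a [^] k) \<otimes> inv g = a [^] l"
    "modular_hom G T \<phi> g = of_int k / of_int l" using modular_hom_witness[OF g a] .
  have "rat_of_int (m * l) = rat_of_int (k * n)" using r kl mn by (simp add: frac_eq_eq)
  then have e: "m * l = k * n" by (simp only: of_int_eq_iff)
  then have "m dvd k" using mn(3) by (metis coprime_dvd_mult_left_iff dvd_triv_left)
  then obtain q where q: "k = m * q" by (auto simp: dvd_def)
  then have l: "l = n * q" using e mn by (simp add: ac_simps)
  define c where "c = a [^] q"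
  have ac: "a \<in> carrier G" using elliptic_carrier[OF a(1)] .
  have c: "c \<in> carrier G" "g \<otimes> c [^] m \<otimes> inv g = c [^] n"
    using ac kl(3) q l by (simp_all add: c_def int_pow_pow mult.commute)
  have "c \<noteq> \<one>" using elliptic_torsion_free[OF a, of q] kl q by (auto simp: c_def)
  moreover obtain y where y: "y \<in> pverts T" "a \<in> stab y" using a by (auto simp: elliptic_iff)
  then have "elliptic G T \<phi> c" using stab_pow[OF y, of q] by (auto simp: c_def elliptic_iff)
  moreover have "\<bar>modular_hom G T \<phi> g\<bar> \<noteq> 1"
  proof
    assume "\<bar>modular_hom G T \<phi> g\<bar> = 1"
    then have "rat_of_int \<bar>m\<bar> = rat_of_int \<bar>n\<bar>" using r mn by (simp add: abs_divide)
    then show False using ne by (simp only: of_int_eq_iff)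
  qed
  ultimately obtain F where "F \<in> hom (BS m n) G" "F (BS_a m n) = c" "F (BS_t m n) = g"
    "elliptic G T \<phi> c" "c \<noteq> \<one>" "\<bar>modular_hom G T \<phi> g\<bar> \<noteq> 1"
    using BS_lift[OF c(1) g c(2)] by metis
  then show ?thesis using that BS_hom_injective_ascending[of F m n] True by blast
next
  case False
  then have "\<bar>m\<bar> \<ge> 2" "\<bar>n\<bar> \<ge> 2" using mn by auto
  then obtain c h v B L where pp: "ping_pong_pair c h m n v B L" "c \<noteq> \<one>"
    "h \<otimes> c [^] m \<otimes> inv h = c [^] n" using ping_pong_pair_exists[OF g r mn(3)] by blast
  have "c \<in> carrier G" "h \<in> carrier G" using pp(1) by (auto simp: ping_pong_pair_def stab_iff)
  then obtain F where "F \<in> hom (BS m n) G" "F (BS_a m n) = c" "F (BS_t m n) = h"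
    using BS_lift pp(3) by metis
  then show ?thesis using that BS_hom_injective_ping_pong[of F m n] pp by blast
qed

text \<open>
  The image of \<open>a\<close> must be elliptic, since translation lengths rule out that \<open>t\<close> conjugates the \<open>m\<close>-th power
  of a hyperbolic element to its \<open>n\<close>-th power.
\<close>

lemma (in GBS_action) BS_subgroup_modulus:
  assumes mn: "m \<noteq> 0" "n \<noteq> 0" "\<bar>m\<bar> \<noteq> \<bar>n\<bar>"
    and H: "subgroup H G" and iso: "G\<lparr>carrier := H\<rparr> \<cong> BS m n"
  shows "\<exists>g\<in>carrier G. modular_hom G T \<phi> g = of_int m / of_int n"
proof -
  interpret K: group "BS m n" by (rule group_BS)
  let ?a = "BS_a m n" and ?t = "BS_t m n"
  have "BS m n \<cong> G\<lparr>carrier := H\<rparr>"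
    using group.iso_sym[OF subgroup.subgroup_is_group[OF H is_group] iso] .
  then obtain F where F: "F \<in> iso (BS m n) (G\<lparr>carrier := H\<rparr>)" by (auto simp: is_iso_def)
  have "F \<in> hom (BS m n) G"
    using F subgroup.subset[OF H] by (auto simp: iso_def hom_def Pi_iff)
  then interpret F: group_hom "BS m n" G F by unfold_locales
  have inj: "inj_on F (carrier (BS m n))" using F by (auto simp: iso_def bij_betw_def)
  have car: "F ?a \<in> carrier G" "F ?t \<in> carrier G" using BS_gens_closed by auto
  have nontriv: "F ?a \<noteq> \<one>"
    using inj_onD[OF inj, of ?a "\<one>\<^bsub>BS m n\<^esub>"] BS_gens_closed[of m n] BS_a_nontrivial[OF mn(1,2)] by auto
  have "F (?t \<otimes>\<^bsub>BS m n\<^esub> ?a [^]\<^bsub>BS m n\<^esub> m \<otimes>\<^bsub>BS m n\<^esub> inv\<^bsub>BS m n\<^esub> ?t) = F (?a [^]\<^bsub>BS m n\<^esub> n)"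
    by (simp only: BS_relation)
  then have rel: "F ?t \<otimes> F ?a [^] m \<otimes> inv (F ?t) = F ?a [^] n"
    using BS_gens_closed[of m n] by (simp add: F.hom_int_pow)
  have "elliptic G T \<phi> (F ?a)" using hyperbolic_conj_powers[OF car(1,2) _ rel] mn(3) by blast
  then show ?thesis using modular_hom_eqI[OF car(2) _ nontriv mn(1,2) rel] car(2) by blast
qed

theorem proposition7p5:
  fixes G :: "('g, 's) monoid_scheme"
    and T :: "'v pair_pre_digraph"
    and \<phi> :: "'g \<Rightarrow> 'v \<Rightarrow> 'v"
    and r :: rat and m n :: int
  assumes "GBS_action G T \<phi>"
    and "\<not> elementary_GBS G"
    and "m \<noteq> 0" and "n \<noteq> 0" and "coprime m n"
    and "r = of_int m / of_int n"
    and "r \<noteq> 1" and "r \<noteq> -1"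
  shows "r \<in> modular_hom G T \<phi> ` carrier G \<longleftrightarrow>
    (\<exists>H. subgroup H G \<and> G\<lparr>carrier := H\<rparr> \<cong> BS m n)"
proof -
  interpret GBS_action G T \<phi> by fact
  have ne: "\<bar>m\<bar> \<noteq> \<bar>n\<bar>"
  proof
    assume "\<bar>m\<bar> = \<bar>n\<bar>"
    then have "m = n \<or> m = - n" by (auto simp: abs_if split: if_splits)
    then show False using assms by auto
  qed
  show ?thesis
  proof
    assume "r \<in> modular_hom G T \<phi> ` carrier G"
    then obtain g where g: "g \<in> carrier G" "modular_hom G T \<phi> g = of_int m / of_int n"
      using assms(6) by auto
    obtain F where F: "F \<in> hom (BS m n) G"
      "\<And>x. x \<in> carrier (BS m n) \<Longrightarrow> F x = \<one>\<^bsub>G\<^esub> \<Longrightarrow> x = \<one>\<^bsub>BS m n\<^esub>"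
      using BS_embeds[OF g assms(3-5) ne] by blast
    interpret K: group "BS m n" by (rule group_BS)
    interpret F: group_hom "BS m n" G F by unfold_locales (rule F(1))
    have "inj_on F (carrier (BS m n))" using F(2) by (simp add: F.inj_on_one_iff)
    then have "F \<in> iso (BS m n) (G\<lparr>carrier := F ` carrier (BS m n)\<rparr>)"
      using F(1) by (auto simp: iso_def hom_def bij_betw_def)
    then have "BS m n \<cong> G\<lparr>carrier := F ` carrier (BS m n)\<rparr>" by (auto simp: is_iso_def)
    then show "\<exists>H. subgroup H G \<and> G\<lparr>carrier := H\<rparr> \<cong> BS m n"
      using K.iso_sym F.img_is_subgroup by blast
  next
    assume "\<exists>H. subgroup H G \<and> G\<lparr>carrier := H\<rparr> \<cong> BS m n"
    then show "r \<in> modular_hom G T \<phi> ` carrier G"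
      using BS_subgroup_modulus[OF assms(3,4) ne] assms(6) by (metis image_eqI)
  qed
qed

end
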